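(* Let $$\mathbb{H}_{\infty}=\left\{(z_1,z_2)\in\mathbb{C}^2:\ |z_2|<\exp\left(-\frac{1}{|z_1|}\right),\ 0<|z_1|<1\right\}.$$ Let $p\in(1,\infty)$. Then the (unweighted) Bergman projection $\mathbf{B}_{\mathbb{H}_{\infty}}$ is bounded on $L^p(\mathbb{H}_{\infty})$ if and only if $p=2$.
   Context: $L^p(\mathbb{H}_{\infty})$ is taken with respect to Lebesgue measure $dV$ on $\mathbb{C}^2$, with norm $\|f\|_p$. The Bergman projection $\mathbf{B}_{\mathbb{H}_{\infty}}$ is the orthogonal projection from $L^2(\mathbb{H}_{\infty})$ onto its closed subspace of square integrable holomorphic functions on $\mathbb{H}_{\infty}$. "Bounded on $L^p(\mathbb{H}_{\infty})$" means that there is a constant $C>0$ with $\|\mathbf{B}_{\mathbb{H}_{\infty}}f\|_p\le C\|f\|_p$ for all $f\in L^2(\mathbb{H}_{\infty})\cap L^p(\mathbb{H}_{\infty})$ (equivalently, that the operator extends to a bounded operator from $L^p(\mathbb{H}_{\infty})$ to itself). *)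

theory Defs
  imports "HOL-Analysis.Analysis"
begin

definition H_infinity :: "(complex \<times> complex) set" where
  "H_infinity = {(z1, z2). cmod z2 < exp (- (1 / cmod z1)) \<and> 0 < cmod z1 \<and> cmod z1 < 1}"

text \<open>Functions are honest representatives, not classes modulo null sets; values outside
  \<open>\<Omega>\<close> are irrelevant. The exponent \<open>p\<close> is meant to satisfy \<open>1 \<le> p < \<infinity>\<close>.\<close>

definition Lp_space :: "(complex \<times> complex) set \<Rightarrow> real \<Rightarrow> (complex \<times> complex \<Rightarrow> complex) set" where
  "Lp_space \<Omega> p = {f. f \<in> borel_measurable (lebesgue_on \<Omega>) \<and>
     integrable (lebesgue_on \<Omega>) (\<lambda>z. cmod (f z) powr p)}"

text \<open>Only meaningful on \<^const>\<open>Lp_space\<close>: the Bochner integral of a non-integrable function is 0.\<close>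

definition Lp_norm :: "(complex \<times> complex) set \<Rightarrow> real \<Rightarrow> (complex \<times> complex \<Rightarrow> complex) \<Rightarrow> real" where
  "Lp_norm \<Omega> p f = (LINT z|lebesgue_on \<Omega>. cmod (f z) powr p) powr (1 / p)"

definition L2_inner ::
  "(complex \<times> complex) set \<Rightarrow> (complex \<times> complex \<Rightarrow> complex) \<Rightarrow> (complex \<times> complex \<Rightarrow> complex) \<Rightarrow> complex" where
  "L2_inner \<Omega> f g = (LINT z|lebesgue_on \<Omega>. f z * cnj (g z))"

text \<open>Holomorphy in two variables (on an open set): a \<open>\<complex>\<close>-linear Frechet derivative at every point.\<close>

definition holomorphic2_on ::
  "(complex \<times> complex \<Rightarrow> complex) \<Rightarrow> (complex \<times> complex) set \<Rightarrow> bool" where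
  "holomorphic2_on f \<Omega> \<longleftrightarrow>
     (\<forall>z\<in>\<Omega>. \<exists>a b. (f has_derivative (\<lambda>(h1, h2). a * h1 + b * h2)) (at z))"

definition Bergman_space :: "(complex \<times> complex) set \<Rightarrow> (complex \<times> complex \<Rightarrow> complex) set" where
  "Bergman_space \<Omega> = {f \<in> Lp_space \<Omega> 2. holomorphic2_on f \<Omega>}"

text \<open>The orthogonal projection onto the Bergman space of an open set \<open>\<Omega>\<close>, for \<open>f\<close> in
  \<open>L\<^sup>2(\<Omega>)\<close>. Extending the result by 0 outside \<open>\<Omega>\<close> makes the function unique, since two continuous
  functions that agree almost everywhere on \<open>\<Omega>\<close> agree everywhere on it.\<close>

definition Bergman_projection ::
  "(complex \<times> complex) set \<Rightarrow> (complex \<times> complex \<Rightarrow> complex) \<Rightarrow> (complex \<times> complex \<Rightarrow> complex)" where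
  "Bergman_projection \<Omega> f = (THE g. g \<in> Bergman_space \<Omega> \<and> (\<forall>z. z \<notin> \<Omega> \<longrightarrow> g z = 0) \<and>
     (\<forall>h\<in>Bergman_space \<Omega>. L2_inner \<Omega> (\<lambda>z. f z - g z) h = 0))"

text \<open>The membership \<open>T f \<in> Lp_space \<Omega> p\<close> expresses that the left-hand norm is finite.\<close>

definition bounded_on_Lp ::
  "(complex \<times> complex) set \<Rightarrow> real \<Rightarrow>
   ((complex \<times> complex \<Rightarrow> complex) \<Rightarrow> (complex \<times> complex \<Rightarrow> complex)) \<Rightarrow> bool" where
  "bounded_on_Lp \<Omega> p T \<longleftrightarrow> (\<exists>C>0. \<forall>f \<in> Lp_space \<Omega> 2 \<inter> Lp_space \<Omega> p.
     T f \<in> Lp_space \<Omega> p \<and> Lp_norm \<Omega> p (T f) \<le> C * Lp_norm \<Omega> p f)"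

end

theory Submission
  imports Defs "HOL-Complex_Analysis.Complex_Analysis"
begin

text \<open>The domain is a Reinhardt domain whose cusp at \<open>z\<^sub>1 = 0\<close> is so thin that all monomials \<open>z\<^sub>1\<^sup>-\<^sup>n\<close> are
square integrable. The norms of these monomials in \<open>L\<^sup>p\<close> and \<open>L\<^sup>q\<close>, \<open>1 / p + 1 / q = 1\<close>, are badly balanced
as \<open>n\<close> grows, and this rules out every exponent other than 2.

Let \<open>f = z\<^sub>1\<^sup>-\<^sup>n \<phi> |z\<^sub>1|\<close>. By rotation invariance of the domain, \<open>f\<close> is orthogonal to every part of a
holomorphic function except its Laurent term \<open>A z\<^sub>1\<^sup>-\<^sup>n\<close>, so the projection of \<open>f\<close> is the multiple of \<open>z\<^sub>1\<^sup>-\<^sup>n\<close>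
with the right inner product (\<open>Bergman_projection_radial_times_monomial\<close>). Choosing \<open>\<phi>\<close> extremal for
Hoelder's inequality, boundedness with constant \<open>C\<close> would give
\<open>\<parallel>z\<^sub>1\<^sup>-\<^sup>n\<parallel>\<^sub>p \<parallel>z\<^sub>1\<^sup>-\<^sup>n\<parallel>\<^sub>q \<le> C \<parallel>z\<^sub>1\<^sup>-\<^sup>n\<parallel>\<^sub>2\<^sup>2\<close> for all \<open>n\<close>. Now the integral of \<open>|z\<^sub>1| powr (- s)\<close> over the domain
is \<open>(s / 2e) powr s\<close> up to polynomial factors in \<open>s\<close> (\<open>radial_moment_le\<close>, \<open>radial_moment_ge\<close>): it is the
integral of \<open>u powr s * exp (- 2 u)\<close> against a power of \<open>u = 1 / |z\<^sub>1|\<close>, and the integrand peaks at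
\<open>u = s / 2\<close>. Hence the quotient of the two sides grows like \<open>(p q / 4) ^ n\<close>, and \<open>p q > 4\<close> unless \<open>p = 2\<close>
(\<open>radial_moment_Hoelder_quotient_unbounded\<close>).

For \<open>p = 2\<close> the claim is that the projection exists, as it is then a contraction. The closest point in
the Bergman space is the limit of a minimizing sequence; the limit is taken pointwise, with the
bound \<open>Bergman_space_pointwise_bound\<close> of point values by the \<open>L\<^sup>2\<close> norm making the convergence locally
uniform (\<open>Bergman_space_closest_point\<close>).

Orbit averages over measure-preserving rotations (\<open>integral_flow_average\<close>) reduce the integrals over
regions in \<open>\<complex>\<^sup>2\<close> to means over circles, to which Cauchy's theorem applies; they serve both for the pointwise
bound and for the orthogonality relation.\<close>

section \<open>Rotations preserve Lebesgue measure\<close>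

text \<open>Identifies the plane with \<open>\<real> \<times> \<real>\<close>, so that Fubini's theorem applies.\<close>

lemma lborel_complex_eq_distr:
  "lborel = distr (lborel :: (real \<times> real) measure) borel (\<lambda>(x, y). Complex x y)"
proof (rule lborel_eqI)
  have meas: "(\<lambda>(x, y). Complex x y) \<in> borel_measurable (borel :: (real \<times> real) measure)"
  proof (rule borel_measurable_continuous_onI)
    show "continuous_on UNIV (\<lambda>(x::real, y). Complex x y)"
      unfolding Complex_eq case_prod_unfold by (intro continuous_intros)
  qed
  fix l u :: complex
  assume "\<And>b. b \<in> Basis \<Longrightarrow> l \<bullet> b \<le> u \<bullet> b"
  from this[of 1] this[of \<i>] have "Re l \<le> Re u" "Im l \<le> Im u"
    by (auto simp: Basis_complex_def)
  have "(\<lambda>(x, y). Complex x y) -` box l u = box (Re l, Im l) (Re u, Im u)"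
    by (auto simp: box_def Basis_complex_def Basis_prod_def)
  then show "emeasure (distr lborel borel (\<lambda>(x, y). Complex x y)) (box l u)
      = ennreal (\<Prod>b\<in>Basis. (u - l) \<bullet> b)"
    using \<open>Re l \<le> Re u\<close> \<open>Im l \<le> Im u\<close> meas
    apply (simp add: emeasure_distr emeasure_lborel_box_eq)
    apply (auto simp: Basis_complex_def Basis_prod_def  prod.union_disjoint complex_eq_iff)
    done
qed simp

text \<open>For fixed \<open>y\<close> a shear is a translation in \<open>x\<close>, so the inner integral of Fubini's theorem does not change.\<close>

lemma nn_integral_shear_fst:
  fixes f :: "real \<times> real \<Rightarrow> ennreal"
  assumes [measurable]: "f \<in> borel_measurable borel"
  shows "(\<integral>\<^sup>+(x, y). f (x + a * y, y) \<partial>lborel) = (\<integral>\<^sup>+z. f z \<partial>lborel)"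
proof -
  have "(\<lambda>z. (fst z + a * snd z, snd z)) \<in> borel_measurable borel"
    by (intro borel_measurable_continuous_onI continuous_intros)
  then have [measurable]: "(\<lambda>z. f (fst z + a * snd z, snd z)) \<in> borel_measurable borel"
    using assms by (rule measurable_compose)
  have "(\<integral>\<^sup>+(x, y). f (x + a * y, y) \<partial>lborel) = (\<integral>\<^sup>+y. \<integral>\<^sup>+x. f (x + a * y, y) \<partial>lborel \<partial>lborel)"
    by (subst lborel_prod[symmetric], subst lborel_pair.nn_integral_snd[symmetric])
       (simp_all add: lborel_prod case_prod_unfold)
  also have "\<dots> = (\<integral>\<^sup>+y. \<integral>\<^sup>+x. f (x, y) \<partial>lborel \<partial>lborel)"
  proof (rule nn_integral_cong)
    fix y :: real
    have "(\<integral>\<^sup>+x. f (x, y) \<partial>lborel) = (\<integral>\<^sup>+x. f (x, y) \<partial>distr lborel borel ((+) (a * y)))"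
      by (simp add: lborel_distr_plus)
    also have "\<dots> = (\<integral>\<^sup>+x. f (a * y + x, y) \<partial>lborel)"
      by (subst nn_integral_distr) simp_all
    finally show "(\<integral>\<^sup>+x. f (x + a * y, y) \<partial>lborel) = (\<integral>\<^sup>+x. f (x, y) \<partial>lborel)"
      by (simp add: add.commute)
  qed
  also have "\<dots> = (\<integral>\<^sup>+z. f z \<partial>lborel)"
    using lborel_pair.nn_integral_snd[of f] by (simp add: lborel_prod borel_prod)
  finally show ?thesis .
qed

lemma nn_integral_shear_snd:
  fixes f :: "real \<times> real \<Rightarrow> ennreal"
  assumes [measurable]: "f \<in> borel_measurable borel"
  shows "(\<integral>\<^sup>+(x, y). f (x, y + a * x) \<partial>lborel) = (\<integral>\<^sup>+z. f z \<partial>lborel)"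
proof -
  have "(\<lambda>z. (fst z, snd z + a * fst z)) \<in> borel_measurable borel"
    by (intro borel_measurable_continuous_onI continuous_intros)
  then have [measurable]: "(\<lambda>z. f (fst z, snd z + a * fst z)) \<in> borel_measurable borel"
    using assms by (rule measurable_compose)
  have "(\<integral>\<^sup>+(x, y). f (x, y + a * x) \<partial>lborel) = (\<integral>\<^sup>+x. \<integral>\<^sup>+y. f (x, y + a * x) \<partial>lborel \<partial>lborel)"
    by (subst lborel_prod[symmetric], subst lborel.nn_integral_fst[symmetric])
       (simp_all add: lborel_prod case_prod_unfold)
  also have "\<dots> = (\<integral>\<^sup>+x. \<integral>\<^sup>+y. f (x, y) \<partial>lborel \<partial>lborel)"
  proof (rule nn_integral_cong)
    fix x :: real
    have "(\<integral>\<^sup>+y. f (x, y) \<partial>lborel) = (\<integral>\<^sup>+y. f (x, y) \<partial>distr lborel borel ((+) (a * x)))"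
      by (simp add: lborel_distr_plus)
    also have "\<dots> = (\<integral>\<^sup>+y. f (x, a * x + y) \<partial>lborel)"
      by (subst nn_integral_distr) simp_all
    finally show "(\<integral>\<^sup>+y. f (x, y + a * x) \<partial>lborel) = (\<integral>\<^sup>+y. f (x, y) \<partial>lborel)"
      by (simp add: add.commute)
  qed
  also have "\<dots> = (\<integral>\<^sup>+z. f z \<partial>lborel)"
    using lborel.nn_integral_fst[of f lborel] by (simp add: lborel_prod borel_prod)
  finally show ?thesis .
qed

text \<open>A rotation by an angle that is not a multiple of \<open>\<pi>\<close> is a product of three shears, and each of them
preserves the integral.\<close>

lemma nn_integral_rotate_real:
  fixes f :: "real \<times> real \<Rightarrow> ennreal"
  assumes [measurable]: "f \<in> borel_measurable borel" and cs: "c\<^sup>2 + s\<^sup>2 = 1" and "s \<noteq> 0"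
  shows "(\<integral>\<^sup>+(x, y). f (c * x - s * y, s * x + c * y) \<partial>lborel) = (\<integral>\<^sup>+z. f z \<partial>lborel)"
proof -
  \<comment> \<open>\<open>a = - tan (\<theta> / 2)\<close>: the rotation by \<open>\<theta>\<close> is shear in \<open>x\<close> by \<open>a\<close>, in \<open>y\<close> by \<open>s\<close>, in \<open>x\<close> by \<open>a\<close>\<close>
  define a where "a = (c - 1) / s"
  have c: "c = 1 + a * s" using \<open>s \<noteq> 0\<close> by (simp add: a_def)
  have s: "- s = a + a * c"
  proof -
    have "(a + a * c) * s = (c - 1) * (1 + c)" using \<open>s \<noteq> 0\<close> by (simp add: a_def field_simps)
    also have "\<dots> = - s * s" using cs by (simp add: algebra_simps power2_eq_square)
    finally show ?thesis using \<open>s \<noteq> 0\<close> by (metis mult_right_cancel)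
  qed
  define g where "g = (\<lambda>z. f (fst z + a * snd z, snd z))"
  define h where "h = (\<lambda>z. g (fst z, snd z + s * fst z))"
  have [measurable]: "g \<in> borel_measurable borel" by (simp add: g_def borel_prod[symmetric])
  have [measurable]: "h \<in> borel_measurable borel" by (simp add: h_def borel_prod[symmetric])
  have "f (c * x - s * y, s * x + c * y) = h (x + a * y, y)" for x y
  proof -
    have "c * x - s * y = (x + a * y) + a * (y + s * (x + a * y))"
    proof -
      have "c * x - s * y = c * x + (a + a * c) * y" using s by (simp flip: s)
      then show ?thesis by (simp add: c algebra_simps)
    qed
    moreover have "s * x + c * y = y + s * (x + a * y)" by (simp add: c algebra_simps)
    ultimately show ?thesis by (simp add: h_def g_def)
  qed
  then have "(\<integral>\<^sup>+(x, y). f (c * x - s * y, s * x + c * y) \<partial>lborel)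
      = (\<integral>\<^sup>+(x, y). h (x + a * y, y) \<partial>lborel)" by simp
  also have "\<dots> = (\<integral>\<^sup>+z. h z \<partial>lborel)" by (rule nn_integral_shear_fst) simp
  also have "\<dots> = (\<integral>\<^sup>+z. g z \<partial>lborel)"
    using nn_integral_shear_snd[of g s] by (simp add: h_def case_prod_unfold)
  also have "\<dots> = (\<integral>\<^sup>+z. f z \<partial>lborel)"
    using nn_integral_shear_fst[of f a] by (simp add: g_def case_prod_unfold)
  finally show ?thesis .
qed

lemma nn_integral_rotate_complex:
  fixes f :: "complex \<Rightarrow> ennreal"
  assumes [measurable]: "f \<in> borel_measurable borel" and u: "cmod u = 1"
  shows "(\<integral>\<^sup>+z. f (u * z) \<partial>lborel) = (\<integral>\<^sup>+z. f z \<partial>lborel)"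
proof -
  have meas [measurable]:
    "(\<lambda>z. Complex (fst z) (snd z)) \<in> borel_measurable (borel :: (real \<times> real) measure)"
    unfolding Complex_eq by (intro borel_measurable_continuous_onI continuous_intros)
  have to_real: "(\<integral>\<^sup>+z. g z \<partial>lborel) = (\<integral>\<^sup>+(x, y). g (Complex x y) \<partial>lborel)"
    if [measurable]: "g \<in> borel_measurable borel" for g :: "complex \<Rightarrow> ennreal"
    by (subst lborel_complex_eq_distr, subst nn_integral_distr) (simp_all add: case_prod_unfold)
  have nonreal: "(\<integral>\<^sup>+z. g (v * z) \<partial>lborel) = (\<integral>\<^sup>+z. g z \<partial>lborel)"
    if [measurable]: "g \<in> borel_measurable borel" and "cmod v = 1" "Im v \<noteq> 0"
    for g :: "complex \<Rightarrow> ennreal" and v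
  proof -
    have "v * Complex x y = Complex (Re v * x - Im v * y) (Im v * x + Re v * y)" for x y
      by (simp add: complex_eq_iff algebra_simps)
    moreover have "(Re v)\<^sup>2 + (Im v)\<^sup>2 = 1" using that(2) by (simp add: cmod_def)
    ultimately show ?thesis
      using nn_integral_rotate_real[of "\<lambda>z. g (Complex (fst z) (snd z))" "Re v" "Im v"] that(3)
      by (simp add: to_real case_prod_unfold)
  qed
  \<comment> \<open>the half turn, which is not a product of three such shears, is two quarter turns\<close>
  consider "Im u \<noteq> 0" | "u = 1" | "u = -1"
    using u by (cases "Im u = 0") (auto simp: cmod_def complex_eq_iff abs_if split: if_splits)
  then show ?thesis
  proof cases
    case 3
    have "(\<integral>\<^sup>+z. f (- z) \<partial>lborel) = (\<integral>\<^sup>+z. f (\<i> * (\<i> * z)) \<partial>lborel)" by (simp flip: mult.assoc)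
    also have "\<dots> = (\<integral>\<^sup>+z. f (\<i> * z) \<partial>lborel)" using nonreal[of "\<lambda>z. f (\<i> * z)" \<i>] by simp
    finally show ?thesis using nonreal[of f \<i>] 3 by simp
  qed (use nonreal u in simp_all)
qed

lemma distr_lborel_rotate:
  assumes "cmod u = 1"
  shows "distr lborel borel ((*) u) = (lborel :: complex measure)"
proof (rule measure_eqI)
  fix A :: "complex set" assume "A \<in> sets (distr lborel borel ((*) u))"
  then have [measurable]: "A \<in> sets borel" by simp
  have "emeasure (distr lborel borel ((*) u)) A = (\<integral>\<^sup>+z. indicator A z \<partial>distr lborel borel ((*) u))"
    by simp
  also have "\<dots> = (\<integral>\<^sup>+z. indicator A (u * z) \<partial>lborel)" by (subst nn_integral_distr) simp_all
  also have "\<dots> = (\<integral>\<^sup>+z. indicator A z \<partial>lborel)"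
    by (rule nn_integral_rotate_complex) (use assms in simp_all)
  finally show "emeasure (distr lborel borel ((*) u)) A = emeasure lborel A" by simp
qed simp

lemma distr_lborel_rotate_pair:
  assumes "cmod u = 1" "cmod v = 1"
  shows "distr lborel borel (\<lambda>(x, y). (u * x, v * y)) = (lborel :: (complex \<times> complex) measure)"
proof -
  have "sigma_finite_measure (distr lborel borel ((*) v))"
    unfolding distr_lborel_rotate[OF assms(2)] by unfold_locales
  from pair_measure_distr[OF _ _ this, of "(*) u" lborel borel]
  have "distr lborel borel ((*) u) \<Otimes>\<^sub>M distr lborel borel ((*) v)
      = distr (lborel \<Otimes>\<^sub>M lborel) (borel \<Otimes>\<^sub>M borel) (\<lambda>(x, y). (u * x, v * y))"
    by simp
  then show ?thesis
    by (simp add: distr_lborel_rotate assms lborel_prod borel_prod)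
qed

text \<open>Each \<open>T t\<close> preserves the measure, so \<open>\<integral>F = \<integral>(F \<circ> T t)\<close> for every \<open>t\<close>; integrating over \<open>t \<in> [0, 1]\<close> and
exchanging the integrals replaces \<open>F\<close> by its mean along the orbits. For rotations the orbits are
circles, and the mean is what Cauchy's theorem computes. This is the substitute for polar
coordinates throughout.\<close>

lemma integral_flow_average:
  fixes F :: "'a::euclidean_space \<Rightarrow> complex" and T :: "real \<Rightarrow> 'a \<Rightarrow> 'a"
  assumes inv: "\<And>t. distr lborel borel (T t) = lborel"
    and T: "continuous_on UNIV (\<lambda>(t, z). T t z)"
    and F: "integrable lborel F"
  shows "integrable lborel (\<lambda>z. \<integral>t. indicator {0..1} t *\<^sub>R F (T t z) \<partial>lborel)" (is ?int)
    and "(\<integral>z. F z \<partial>lborel) = (\<integral>z. (\<integral>t. indicator {0..1} t *\<^sub>R F (T t z) \<partial>lborel) \<partial>lborel)"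
      (is ?eq)
proof -
  have [measurable]: "(\<lambda>(t, z). T t z) \<in> borel_measurable (borel \<Otimes>\<^sub>M borel)"
    unfolding borel_prod using T by (rule borel_measurable_continuous_onI)
  have Tt [measurable]: "T t \<in> borel_measurable borel" for t
    using measurable_compose_Pair1[of t borel "(\<lambda>(t, z). T t z)" borel borel] by simp
  have [measurable]: "F \<in> borel_measurable borel" using F by (simp add: borel_measurable_integrable)
  have int: "integrable lborel (\<lambda>z. F (T t z))" for t
    using F by (subst (asm) inv[of t, symmetric]) (simp add: integrable_distr_eq)
  have nrm: "(\<integral>z. norm (F (T t z)) \<partial>lborel) = (\<integral>z. norm (F z) \<partial>lborel)" for t
    by (subst (2) inv[of t, symmetric], subst integral_distr) simp_all
  have eq: "(\<integral>z. F (T t z) \<partial>lborel) = (\<integral>z. F z \<partial>lborel)" for t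
    by (subst (2) inv[of t, symmetric], subst integral_distr) simp_all
  have pair: "integrable (lborel \<Otimes>\<^sub>M lborel) (\<lambda>(t, z). indicator {0..1} t *\<^sub>R F (T t z))"
  proof (rule lborel_pair.Fubini_integrable)
    show "(\<lambda>(t, z). indicator {0..1} t *\<^sub>R F (T t z)) \<in> borel_measurable (lborel \<Otimes>\<^sub>M lborel)"
      by measurable
    have "integrable lborel (\<lambda>t. indicator {0..1::real} t *\<^sub>R (\<integral>z. norm (F z) \<partial>lborel))"
      by (intro integrable_indicator) simp_all
    then show "integrable lborel
        (\<lambda>t. \<integral>z. norm (case (t, z) of (t, z) \<Rightarrow> indicator {0..1} t *\<^sub>R F (T t z)) \<partial>lborel)"
      by (simp add: nrm)
  qed (use int in simp)
  from lborel_pair.integrable_snd[OF pair] show ?int by simp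
  from lborel_pair.Fubini_integral[OF pair]
  have "(\<integral>z. (\<integral>t. indicator {0..1} t *\<^sub>R F (T t z) \<partial>lborel) \<partial>lborel)
      = (\<integral>t. (\<integral>z. indicator {0..1} t *\<^sub>R F (T t z) \<partial>lborel) \<partial>lborel)" by simp
  also have "\<dots> = (\<integral>t. indicator {0..1::real} t *\<^sub>R (\<integral>z. F z \<partial>lborel) \<partial>lborel)" by (simp add: eq)
  also have "\<dots> = (\<integral>z. F z \<partial>lborel)"
    by simp
  finally show ?eq by simp
qed

section \<open>Means of holomorphic functions over circles\<close>

abbreviation unit_exp :: "real \<Rightarrow> complex" where
  "unit_exp t \<equiv> exp (2 * of_real pi * \<i> * of_real t)"

lemma circle_mean_eq_contour_integral:
  assumes g: "continuous_on (sphere 0 (cmod u)) g" and u: "u \<noteq> 0"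
  shows "(\<integral>t. indicator {0..1} t *\<^sub>R g (unit_exp t * u) \<partial>lborel)
    = contour_integral (\<lambda>t. unit_exp t * u) (\<lambda>w. g w / w) / (2 * pi * \<i>)"
proof -
  have cont: "continuous_on {0..1} (\<lambda>t. g (unit_exp t * u))"
    by (rule continuous_on_compose2[OF g]) (auto intro!: continuous_intros simp: norm_mult)
  have "contour_integral (\<lambda>t. unit_exp t * u) (\<lambda>w. g w / w)
      = integral {0..1} (\<lambda>t. g (unit_exp t * u) / (unit_exp t * u)
          * vector_derivative (\<lambda>t. unit_exp t * u) (at t))"
    by (rule contour_integral_integral)
  also have "\<dots> = integral {0..1} (\<lambda>t. 2 * pi * \<i> * g (unit_exp t * u))"
  proof (rule integral_cong)
    fix t :: real
    have "((\<lambda>t. unit_exp t * u) has_vector_derivative (2 * pi * \<i> * unit_exp t * u)) (at t)"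
      by (rule has_vector_derivative_real_field)
         (auto intro!: derivative_eq_intros)
    then have "vector_derivative (\<lambda>t. unit_exp t * u) (at t) = 2 * pi * \<i> * unit_exp t * u"
      by (rule vector_derivative_at)
    then show "g (unit_exp t * u) / (unit_exp t * u) * vector_derivative (\<lambda>t. unit_exp t * u) (at t)
        = 2 * pi * \<i> * g (unit_exp t * u)" using u by simp
  qed
  also have "\<dots> = 2 * pi * \<i> * integral {0..1} (\<lambda>t. g (unit_exp t * u))" by simp
  also have "integral {0..1} (\<lambda>t. g (unit_exp t * u))
      = (\<integral>t. indicator {0..1} t *\<^sub>R g (unit_exp t * u) \<partial>lborel)"
    using set_borel_integral_eq_integral(2)[OF borel_integrable_atLeastAtMost'[OF cont]]
    by (simp add: set_lebesgue_integral_def)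
  finally show ?thesis by simp
qed

lemma circle_mean_holomorphic:
  assumes "g holomorphic_on cball 0 1"
  shows "(\<integral>t. indicator {0..1} t *\<^sub>R g (unit_exp t) \<partial>lborel) = g 0"
proof -
  have "((\<lambda>w. g w / (w - 0)) has_contour_integral (2 * of_real pi * \<i> * g 0)) (circlepath 0 1)"
    by (rule Cauchy_integral_circlepath_simple) (use assms in auto)
  then have "contour_integral (circlepath 0 1) (\<lambda>w. g w / w) = 2 * of_real pi * \<i> * g 0"
    by (simp add: contour_integral_unique)
  moreover have "continuous_on (sphere 0 1) g"
    by (rule continuous_on_subset[OF holomorphic_on_imp_continuous_on[OF assms]]) auto
  ultimately show ?thesis
    using circle_mean_eq_contour_integral[of 1 g] by (simp add: circlepath)
qed

text \<open>The mean is \<open>(1 / 2\<pi>i) \<integral> g w / w dw\<close> over the circle through \<open>z\<close>. The starting point of the circle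
does not matter because the path is a closed loop, and the radius does not matter by Cauchy's
theorem in the annulus. For \<open>g w = w ^ n * h w\<close> this says that the Laurent coefficient of \<open>h\<close> of index
\<open>- n\<close> can be read off from any circle.\<close>

lemma circle_mean_punctured_disc_constant:
  assumes g: "g holomorphic_on ball 0 1 - {0}"
    and z: "0 < cmod z" "cmod z < 1" and w: "0 < cmod w" "cmod w < 1"
  shows "(\<integral>t. indicator {0..1} t *\<^sub>R g (unit_exp t * z) \<partial>lborel)
    = (\<integral>t. indicator {0..1} t *\<^sub>R g (unit_exp t * w) \<partial>lborel)"
proof -
  let ?c = "\<lambda>r. contour_integral (circlepath 0 r) (\<lambda>w. g w / w)"
  have radial: "(\<integral>t. indicator {0..1} t *\<^sub>R g (unit_exp t * u) \<partial>lborel) = ?c (cmod u) / (2 * pi * \<i>)"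
    if "0 < cmod u" "cmod u < 1" for u
  proof -
    define a where "a = Arg2pi u / (2 * pi)"
    have a: "a \<in> {0..1}" using Arg2pi_ge_0[of u] Arg2pi_lt_2pi[of u] by (simp add: a_def)
    have ua: "u = of_real (cmod u) * unit_exp a"
      using Arg2pi_eq[of u] by (simp add: a_def mult_ac)
    have "shiftpath a (circlepath 0 (cmod u)) = (\<lambda>t. unit_exp t * u)"
    proof
      fix t
      have per: "unit_exp (a + t - 1) = unit_exp (a + t)"
        by (simp add: algebra_simps exp_diff)
      have "unit_exp (a + t) * of_real (cmod u) = unit_exp t * u"
        using arg_cong[OF ua, of "(*) (unit_exp t)"] by (simp add: algebra_simps exp_add)
      then show "shiftpath a (circlepath 0 (cmod u)) t = unit_exp t * u"
        using per unfolding shiftpath_def circlepath by (simp add: mult_ac)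
    qed
    then have "contour_integral (\<lambda>t. unit_exp t * u) (\<lambda>w. g w / w) = ?c (cmod u)"
      using contour_integral_shiftpath[of "circlepath 0 (cmod u)" a "\<lambda>w. g w / w"] a by simp
    moreover have "continuous_on (sphere 0 (cmod u)) g"
      by (rule continuous_on_subset[OF holomorphic_on_imp_continuous_on[OF g]]) (use that in auto)
    ultimately show ?thesis using circle_mean_eq_contour_integral[of u g] that by simp
  qed
  have "?c r = ?c s" if "0 < r" "r \<le> s" "s < 1" for r s
    by (rule contour_integral_circlepath_eq(3)[symmetric, of "ball 0 1"])
       (use that g in \<open>auto intro!: holomorphic_intros\<close>)
  then have "?c (cmod z) = ?c (cmod w)" using z w by (metis linear)
  then show ?thesis using radial z w by simp
qed

section \<open>Holomorphic functions of two variables\<close>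

lemma holomorphic2_on_imp_continuous_on:
  assumes "holomorphic2_on f \<Omega>"
  shows "continuous_on \<Omega> f"
  using assms unfolding holomorphic2_on_def
  by (meson continuous_at_imp_continuous_on has_derivative_continuous)

lemma holomorphic2_on_diff:
  assumes "holomorphic2_on f \<Omega>" "holomorphic2_on g \<Omega>"
  shows "holomorphic2_on (\<lambda>z. f z - g z) \<Omega>"
  unfolding holomorphic2_on_def
proof
  fix z assume "z \<in> \<Omega>"
  with assms obtain a b c d where
    "(f has_derivative (\<lambda>(h1, h2). a * h1 + b * h2)) (at z)"
    "(g has_derivative (\<lambda>(h1, h2). c * h1 + d * h2)) (at z)"
    unfolding holomorphic2_on_def by meson
  from has_derivative_diff[OF this]
  have "((\<lambda>z. f z - g z) has_derivative (\<lambda>(h1, h2). (a - c) * h1 + (b - d) * h2)) (at z)"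
    by (simp add: case_prod_unfold algebra_simps)
  then show "\<exists>a b. ((\<lambda>z. f z - g z) has_derivative (\<lambda>(h1, h2). a * h1 + b * h2)) (at z)"
    by blast
qed

lemma holomorphic2_on_cmult:
  assumes "holomorphic2_on f \<Omega>"
  shows "holomorphic2_on (\<lambda>z. k * f z) \<Omega>"
  unfolding holomorphic2_on_def
proof
  fix z assume "z \<in> \<Omega>"
  with assms obtain a b where
    "(f has_derivative (\<lambda>(h1, h2). a * h1 + b * h2)) (at z)"
    unfolding holomorphic2_on_def by meson
  from has_derivative_mult_right[OF this, of k]
  have "((\<lambda>z. k * f z) has_derivative (\<lambda>(h1, h2). (k * a) * h1 + (k * b) * h2)) (at z)"
    by (simp add: case_prod_unfold algebra_simps)
  then show "\<exists>a b. ((\<lambda>z. k * f z) has_derivative (\<lambda>(h1, h2). a * h1 + b * h2)) (at z)"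
    by blast
qed

lemma holomorphic2_on_cong:
  assumes "holomorphic2_on f \<Omega>" "open \<Omega>" "\<And>z. z \<in> \<Omega> \<Longrightarrow> f z = g z"
  shows "holomorphic2_on g \<Omega>"
  unfolding holomorphic2_on_def
proof
  fix z assume z: "z \<in> \<Omega>"
  with assms(1) obtain a b where
    "(f has_derivative (\<lambda>(h1, h2). a * h1 + b * h2)) (at z)"
    unfolding holomorphic2_on_def by meson
  from has_derivative_transform_within_open[OF this assms(2) z] assms(3)
  have "(g has_derivative (\<lambda>(h1, h2). a * h1 + b * h2)) (at z)" by simp
  then show "\<exists>a b. (g has_derivative (\<lambda>(h1, h2). a * h1 + b * h2)) (at z)"
    by blast
qed

text \<open>Restriction to complex lines is how the theory of one variable enters.\<close>

lemma holomorphic2_on_complex_line: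
  assumes f: "holomorphic2_on f \<Omega>" and S: "\<And>w. w \<in> S \<Longrightarrow> (a + w * u, b + w * v) \<in> \<Omega>"
  shows "(\<lambda>w. f (a + w * u, b + w * v)) holomorphic_on S"
proof (rule holomorphic_onI)
  fix w assume "w \<in> S"
  with f S obtain p q where
    fd: "(f has_derivative (\<lambda>(h1, h2). p * h1 + q * h2)) (at (a + w * u, b + w * v))"
    unfolding holomorphic2_on_def by meson
  have ld: "((\<lambda>w. (a + w * u, b + w * v)) has_derivative (\<lambda>h. (h * u, h * v))) (at w within S)"
    by (auto intro!: derivative_eq_intros)
  have "((\<lambda>w. f (a + w * u, b + w * v)) has_derivative (\<lambda>h. p * (h * u) + q * (h * v)))
      (at w within S)"
    using has_derivative_compose[OF ld fd] by simp
  also have "(\<lambda>h. p * (h * u) + q * (h * v)) = (*) (p * u + q * v)"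
    by (auto simp: algebra_simps)
  finally show "(\<lambda>w. f (a + w * u, b + w * v)) field_differentiable (at w within S)"
    unfolding field_differentiable_def has_field_derivative_def by blast
qed

section \<open>The pointwise bound for the Bergman space\<close>

text \<open>Functions in the Bergman space are continuous, so for them integrals over \<^term>\<open>lebesgue_on \<Omega>\<close> are
integrals of Borel functions with respect to \<^term>\<open>lborel\<close>, a product measure whose images under
rotations are known.\<close>

lemma continuous_on_open_indicator_measurable:
  fixes f :: "'a::euclidean_space \<Rightarrow> 'b::euclidean_space"
  assumes "open \<Omega>" "continuous_on \<Omega> f"
  shows "(\<lambda>z. indicator \<Omega> z *\<^sub>R f z) \<in> borel_measurable borel"
  using borel_measurable_continuous_on_indicator[of \<Omega> f] assms by simp

lemma continuous_on_open_measurable_lebesgue_on: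
  fixes f :: "'a::euclidean_space \<Rightarrow> 'b::euclidean_space"
  assumes "open \<Omega>" "continuous_on \<Omega> f"
  shows "f \<in> borel_measurable (lebesgue_on \<Omega>)"
  using assms by (intro continuous_imp_measurable_on_sets_lebesgue) auto

lemma integrable_lebesgue_on_open_iff:
  fixes f :: "'a::euclidean_space \<Rightarrow> 'b::euclidean_space"
  assumes "open \<Omega>" "continuous_on \<Omega> f"
  shows "integrable (lebesgue_on \<Omega>) f \<longleftrightarrow> integrable lborel (\<lambda>z. indicator \<Omega> z *\<^sub>R f z)"
  using continuous_on_open_indicator_measurable[OF assms] assms(1)
  by (simp add: integrable_restrict_space integrable_completion)

lemma integral_lebesgue_on_open:
  fixes f :: "'a::euclidean_space \<Rightarrow> 'b::euclidean_space"
  assumes "open \<Omega>" "continuous_on \<Omega> f"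
  shows "(LINT z|lebesgue_on \<Omega>. f z) = (\<integral>z. indicator \<Omega> z *\<^sub>R f z \<partial>lborel)"
  using continuous_on_open_indicator_measurable[OF assms] assms(1)
  by (simp add: integral_restrict_space integral_completion)

definition sqnorm :: "(complex \<times> complex) set \<Rightarrow> (complex \<times> complex \<Rightarrow> complex) \<Rightarrow> real" where
  "sqnorm \<Omega> f = (LINT z|lebesgue_on \<Omega>. (cmod (f z))\<^sup>2)"

lemma Lp_space_2_iff:
  "f \<in> Lp_space \<Omega> 2 \<longleftrightarrow>
    f \<in> borel_measurable (lebesgue_on \<Omega>) \<and> integrable (lebesgue_on \<Omega>) (\<lambda>z. (cmod (f z))\<^sup>2)"
  by (simp add: Lp_space_def powr_numeral)

text \<open>The volume integral of the holomorphic function \<open>f\<^sup>2\<close> over a ball with centre \<open>c\<close> is the volume times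
\<open>(f c)\<^sup>2\<close>: averaging over the joint rotation of both coordinates about \<open>c\<close> turns the integrand into the
constant \<open>(f c)\<^sup>2\<close>, because each orbit is a circle with centre \<open>c\<close> in a complex line. The choice
of \<open>f\<^sup>2\<close> makes the modulus of the integrand the density of the squared \<open>L\<^sup>2\<close> norm.\<close>

lemma Bergman_space_pointwise_bound:
  assumes f: "f \<in> Bergman_space \<Omega>" and \<Omega>: "open \<Omega>" and ball: "ball c r \<subseteq> \<Omega>"
  shows "(cmod (f c))\<^sup>2 * measure lborel (ball (0 :: complex \<times> complex) r) \<le> sqnorm \<Omega> f"
proof -
  have hol: "holomorphic2_on f \<Omega>" and int: "integrable (lebesgue_on \<Omega>) (\<lambda>z. (cmod (f z))\<^sup>2)"
    using f by (auto simp: Bergman_space_def Lp_space_2_iff)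
  have cont: "continuous_on \<Omega> f" using hol by (rule holomorphic2_on_imp_continuous_on)
  have int': "integrable lborel (\<lambda>z. indicator \<Omega> z *\<^sub>R (cmod (f z))\<^sup>2)"
    using int by (subst (asm) integrable_lebesgue_on_open_iff[OF \<Omega>])
      (auto intro!: continuous_intros cont)
  define G where "G z = indicator (ball c r) z *\<^sub>R (f z)\<^sup>2" for z
  define F where "F z = G (c + z)" for z
  have intG: "integrable lborel G"
  proof (rule Bochner_Integration.integrable_bound[OF int'])
    show "G \<in> borel_measurable lborel"
      unfolding G_def using ball continuous_on_subset[OF cont ball]
      by (simp, intro continuous_on_open_indicator_measurable) (auto intro!: continuous_intros)
    show "AE z in lborel. norm (G z) \<le> norm (indicator \<Omega> z *\<^sub>R (cmod (f z))\<^sup>2)"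
      using ball by (intro AE_I2) (auto simp: G_def indicator_def norm_power)
  qed
  have meas [measurable]: "G \<in> borel_measurable borel" using intG by auto
  have intF: "integrable lborel F"
    using intG unfolding F_def
    by (subst (asm) lborel_distr_plus[of c, symmetric]) (simp add: integrable_distr_eq)
  have normF: "(\<integral>z. cmod (F z) \<partial>lborel) = (\<integral>z. cmod (G z) \<partial>lborel)"
    unfolding F_def by (subst (2) lborel_distr_plus[of c, symmetric], subst integral_distr) simp_all
  define T where "T t = (\<lambda>(x, y). (unit_exp t * x, unit_exp t * y))" for t
  have "distr lborel borel (T t) = lborel" for t
    unfolding T_def by (rule distr_lborel_rotate_pair) simp_all
  moreover have "continuous_on UNIV (\<lambda>(t, z). T t z)"
    unfolding T_def case_prod_unfold by (intro continuous_intros)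
  ultimately have "(\<integral>z. F z \<partial>lborel)
      = (\<integral>z. (\<integral>t. indicator {0..1} t *\<^sub>R F (T t z) \<partial>lborel) \<partial>lborel)"
    using intF by (rule integral_flow_average)
  also have "\<dots> = (\<integral>z. indicator (ball (0 :: complex \<times> complex) r) z *\<^sub>R (f c)\<^sup>2 \<partial>lborel)"
  proof (rule Bochner_Integration.integral_cong[OF refl])
    fix z :: "complex \<times> complex"
    obtain x y where z: "z = (x, y)" by fastforce
    obtain a b where c: "c = (a, b)" by fastforce
    have norm_line: "norm (w * x, w * y) = cmod w * norm z" for w
      by (simp add: z norm_Pair norm_mult power_mult_distrib flip: distrib_left)
         (simp add: real_sqrt_mult)
    have dist_add: "dist c (c + v) = norm v" for v by (simp add: dist_norm)
    have FT: "F (T t z) = indicator (ball 0 r) z *\<^sub>R (f (a + unit_exp t * x, b + unit_exp t * y))\<^sup>2" for t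
    proof -
      have "c + T t z \<in> ball c r \<longleftrightarrow> z \<in> ball 0 r"
        unfolding mem_ball dist_add using norm_line[of "unit_exp t"] by (simp add: T_def z)
      then show ?thesis by (simp add: F_def G_def indicator_def) (simp add: T_def z c)
    qed
    show "(\<integral>t. indicator {0..1} t *\<^sub>R F (T t z) \<partial>lborel) = indicator (ball 0 r) z *\<^sub>R (f c)\<^sup>2"
    proof (cases "z \<in> ball 0 r")
      case True
      have "(a + w * x, b + w * y) \<in> \<Omega>" if "w \<in> cball 0 1" for w
      proof -
        have "dist c (a + w * x, b + w * y) = norm (w * x, w * y)" by (simp add: c dist_norm norm_Pair)
        also have "\<dots> \<le> norm z" using that norm_line[of w] by (simp add: mult_left_le_one_le)
        finally show ?thesis using ball True by auto
      qed
      then have "(\<lambda>w. (f (a + w * x, b + w * y))\<^sup>2) holomorphic_on cball 0 1"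
        by (intro holomorphic_intros holomorphic2_on_complex_line[OF hol]) auto
      from circle_mean_holomorphic[OF this] True show ?thesis by (simp add: FT c)
    qed (simp add: FT)
  qed
  also have "\<dots> = measure lborel (ball (0 :: complex \<times> complex) r) *\<^sub>R (f c)\<^sup>2"
    by (subst integral_scaleR_left) (auto intro!: integrable_real_indicator emeasure_bounded_finite)
  finally have "(\<integral>z. F z \<partial>lborel) = measure lborel (ball (0 :: complex \<times> complex) r) *\<^sub>R (f c)\<^sup>2" .
  then have "(cmod (f c))\<^sup>2 * measure lborel (ball (0 :: complex \<times> complex) r) = cmod (\<integral>z. F z \<partial>lborel)"
    by (simp add: norm_power)
  also have "\<dots> \<le> (\<integral>z. cmod (F z) \<partial>lborel)" by simp
  also have "\<dots> \<le> (\<integral>z. indicator \<Omega> z *\<^sub>R (cmod (f z))\<^sup>2 \<partial>lborel)"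
    unfolding normF using ball
    by (intro integral_mono int' integrable_norm intG) (auto simp: G_def indicator_def norm_power)
  also have "\<dots> = sqnorm \<Omega> f"
    unfolding sqnorm_def by (subst integral_lebesgue_on_open[OF \<Omega>]) (auto intro!: continuous_intros cont)
  finally show ?thesis .
qed

section \<open>Locally uniform limits of holomorphic functions\<close>

lemma holomorphic2_Cauchy_estimate:
  assumes f: "holomorphic2_on f \<Omega>" and r: "0 < r" and ball: "cball (x, y) r \<subseteq> \<Omega>"
    and bound: "\<And>z. z \<in> cball (x, y) r \<Longrightarrow> cmod (f z) \<le> M"
    and D: "(f has_derivative (\<lambda>(h1, h2). a * h1 + b * h2)) (at (x, y))"
    and uv: "norm (u, v) = 1"
  shows "cmod (a * u + b * v) \<le> M / r"
proof -
  define g where "g w = f (x + w * u, y + w * v)" for w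
  have norm_line: "norm (w * u, w * v) = cmod w * norm (u, v)" for w
    by (simp add: norm_Pair norm_mult power_mult_distrib flip: distrib_left)
       (simp add: real_sqrt_mult)
  have line: "(x + w * u, y + w * v) \<in> cball (x, y) r" if "cmod w \<le> r" for w
  proof -
    have "dist (x, y) (x + w * u, y + w * v) = norm (w * u, w * v)" by (simp add: dist_norm norm_Pair)
    then show ?thesis using that uv norm_line by simp
  qed
  have hol: "g holomorphic_on cball 0 r"
    unfolding g_def by (rule holomorphic2_on_complex_line[OF f]) (use line ball in auto)
  have "cmod ((deriv ^^ 1) g 0) \<le> fact 1 * M / r ^ 1"
  proof (rule Cauchy_inequality[OF _ _ r])
    show "g holomorphic_on ball 0 r" using hol by (rule holomorphic_on_subset) auto
    show "continuous_on (cball 0 r) g" using hol by (rule holomorphic_on_imp_continuous_on)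
    show "cmod (g w) \<le> M" if "cmod (0 - w) = r" for w
      unfolding g_def by (rule bound[OF line]) (use that in simp)
  qed
  moreover have "deriv g 0 = a * u + b * v"
  proof (rule DERIV_imp_deriv)
    have ld: "((\<lambda>w. (x + w * u, y + w * v)) has_derivative (\<lambda>h. (h * u, h * v))) (at 0)"
      by (auto intro!: derivative_eq_intros)
    have "(g has_derivative (\<lambda>h. a * (h * u) + b * (h * v))) (at 0)"
      unfolding g_def using has_derivative_compose[OF ld, of f "\<lambda>(h1, h2). a * h1 + b * h2"] D by simp
    also have "(\<lambda>h. a * (h * u) + b * (h * v)) = (*) (a * u + b * v)"
      by (auto simp: algebra_simps)
    finally show "(g has_field_derivative (a * u + b * v)) (at 0)"
      by (simp add: has_field_derivative_def)
  qed
  ultimately show ?thesis by simp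
qed

text \<open>By the Cauchy estimates on slightly smaller balls the two partial derivatives converge uniformly as
well, so the theorem on the derivative of a limit applies, and it gives a derivative that is again
complex linear.\<close>

lemma holomorphic2_on_locally_uniform_limit:
  assumes hol: "\<And>n. holomorphic2_on (h n) \<Omega>" and \<Omega>: "open \<Omega>"
    and Cauchy: "\<And>c. c \<in> \<Omega> \<Longrightarrow> \<exists>r>0. cball c r \<subseteq> \<Omega> \<and> uniformly_Cauchy_on (cball c r) h"
    and lim: "\<And>z. z \<in> \<Omega> \<Longrightarrow> (\<lambda>n. h n z) \<longlonglongrightarrow> g z"
  shows "holomorphic2_on g \<Omega>"
proof -
  have "\<forall>n z. \<exists>a b. z \<in> \<Omega> \<longrightarrow> (h n has_derivative (\<lambda>(h1, h2). a * h1 + b * h2)) (at z)"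
    using hol unfolding holomorphic2_on_def by blast
  then obtain A B where
    D: "\<And>n z. z \<in> \<Omega> \<Longrightarrow> (h n has_derivative (\<lambda>(h1, h2). A n z * h1 + B n z * h2)) (at z)"
    unfolding choice_iff by blast
  have "\<exists>a b. (g has_derivative (\<lambda>(h1, h2). a * h1 + b * h2)) (at c)" if c: "c \<in> \<Omega>" for c
  proof -
    obtain r where r: "r > 0" "cball c r \<subseteq> \<Omega>" and UC: "uniformly_Cauchy_on (cball c r) h"
      using Cauchy[OF c] by blast
    have sub: "cball x (r / 2) \<subseteq> cball c r" if "x \<in> ball c (r / 2)" for x
    proof
      fix y assume "y \<in> cball x (r / 2)"
      then show "y \<in> cball c r" using that dist_triangle[of c y x] by (simp add: dist_commute)
    qed
    have ball_\<Omega>: "ball c (r / 2) \<subseteq> \<Omega>" using r by auto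
    have est: "\<exists>N. \<forall>m\<ge>N. \<forall>n\<ge>N. \<forall>x\<in>ball c (r / 2). cmod (A m x - A n x) < e \<and> cmod (B m x - B n x) < e"
      if "e > 0" for e
    proof -
      have "e * r / 4 > 0" using \<open>e > 0\<close> r by simp
      then obtain N where N: "\<And>m n z. m \<ge> N \<Longrightarrow> n \<ge> N \<Longrightarrow> z \<in> cball c r \<Longrightarrow> dist (h m z) (h n z) < e * r / 4"
        using UC unfolding uniformly_Cauchy_on_def by meson
      have "cmod (A m x - A n x) < e \<and> cmod (B m x - B n x) < e"
        if mn: "m \<ge> N" "n \<ge> N" and x: "x \<in> ball c (r / 2)" for m n x
      proof -
        obtain x1 x2 where x12: "x = (x1, x2)" by fastforce
        have hold: "holomorphic2_on (\<lambda>z. h m z - h n z) \<Omega>" by (intro holomorphic2_on_diff hol)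
        have Dd: "((\<lambda>z. h m z - h n z) has_derivative
            (\<lambda>(h1, h2). (A m x - A n x) * h1 + (B m x - B n x) * h2)) (at (x1, x2))"
        proof -
          have "x \<in> \<Omega>" using x ball_\<Omega> by blast
          from has_derivative_diff[OF D[OF this] D[OF this]] show ?thesis
            by (simp add: case_prod_unfold algebra_simps flip: x12)
        qed
        have est: "cmod ((A m x - A n x) * u + (B m x - B n x) * v) \<le> (e * r / 4) / (r / 2)"
          if "norm (u, v) = 1" for u v
        proof (rule holomorphic2_Cauchy_estimate[OF hold _ _ _ Dd that])
          show "cball (x1, x2) (r / 2) \<subseteq> \<Omega>" using sub[OF x] r x12 by auto
          show "cmod (h m z - h n z) \<le> e * r / 4" if "z \<in> cball (x1, x2) (r / 2)" for z
            using N[OF mn, of z] sub[OF x] that x12 by (auto simp: dist_norm)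
        qed (use r in simp)
        have "(e * r / 4) / (r / 2) < e" using r \<open>e > 0\<close> by simp
        with est[of 1 0] est[of 0 1] show ?thesis by (simp add: norm_Pair)
      qed
      then show ?thesis by blast
    qed
    have "uniformly_Cauchy_on (ball c (r / 2)) A \<and> uniformly_Cauchy_on (ball c (r / 2)) B"
    proof (intro conjI uniformly_Cauchy_onI)
      fix e :: real assume "e > 0"
      from est[OF this] obtain N where "\<forall>m\<ge>N. \<forall>n\<ge>N. \<forall>x\<in>ball c (r / 2).
          cmod (A m x - A n x) < e \<and> cmod (B m x - B n x) < e" ..
      then show "\<exists>M. \<forall>x\<in>ball c (r / 2). \<forall>m\<ge>M. \<forall>n\<ge>M. dist (A m x) (A n x) < e"
        "\<exists>M. \<forall>x\<in>ball c (r / 2). \<forall>m\<ge>M. \<forall>n\<ge>M. dist (B m x) (B n x) < e"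
        unfolding dist_norm by blast+
    qed
    then obtain a b where
      a: "uniform_limit (ball c (r / 2)) A a sequentially" and
      b: "uniform_limit (ball c (r / 2)) B b sequentially"
      unfolding uniformly_convergent_eq_Cauchy[symmetric] uniformly_convergent_on_def by blast
    have "\<exists>g'. \<forall>x\<in>ball c (r / 2). (\<lambda>n. h n x) \<longlonglongrightarrow> g' x \<and>
        (g' has_derivative (\<lambda>(h1, h2). a x * h1 + b x * h2)) (at x within ball c (r / 2))"
    proof (rule has_derivative_sequence[where f' = "\<lambda>n x. \<lambda>(h1, h2). A n x * h1 + B n x * h2"
          and g' = "\<lambda>x. \<lambda>(h1, h2). a x * h1 + b x * h2" and ?x0.0 = c and l = "g c"])
      show "(h n has_derivative (\<lambda>(h1, h2). A n x * h1 + B n x * h2)) (at x within ball c (r / 2))"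
        if "x \<in> ball c (r / 2)" for n x
        by (rule has_derivative_at_withinI[OF D]) (use that ball_\<Omega> in blast)
      show "(\<lambda>n. h n c) \<longlonglongrightarrow> g c" using lim[OF c] .
      fix e :: real assume "e > 0"
      then have "e / 2 > 0" by simp
      have "\<forall>\<^sub>F n in sequentially. \<forall>x\<in>ball c (r / 2). cmod (A n x - a x) < e / 2"
        "\<forall>\<^sub>F n in sequentially. \<forall>x\<in>ball c (r / 2). cmod (B n x - b x) < e / 2"
        using a b \<open>e / 2 > 0\<close> unfolding uniform_limit_iff dist_norm by blast+
      then show "\<forall>\<^sub>F n in sequentially. \<forall>x\<in>ball c (r / 2). \<forall>k.
          cmod ((case k of (h1, h2) \<Rightarrow> A n x * h1 + B n x * h2) - (case k of (h1, h2) \<Rightarrow> a x * h1 + b x * h2))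
          \<le> e * norm k"
      proof eventually_elim
        case (elim n)
        show ?case
        proof (intro ballI allI)
          fix x k :: "complex \<times> complex" assume x: "x \<in> ball c (r / 2)"
          obtain k1 k2 where k: "k = (k1, k2)" by fastforce
          have "cmod ((A n x - a x) * k1 + (B n x - b x) * k2)
              \<le> cmod (A n x - a x) * cmod k1 + cmod (B n x - b x) * cmod k2"
            by (metis norm_mult norm_triangle_ineq)
          also have "\<dots> \<le> (e / 2) * norm k + (e / 2) * norm k"
            using elim x norm_fst_le[of k1 k2] norm_snd_le[of k2 k1] \<open>e > 0\<close>
            by (intro add_mono mult_mono) (auto simp: k less_imp_le)
          finally show "cmod ((case k of (h1, h2) \<Rightarrow> A n x * h1 + B n x * h2)
              - (case k of (h1, h2) \<Rightarrow> a x * h1 + b x * h2)) \<le> e * norm k"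
            by (simp add: k algebra_simps)
        qed
      qed
    qed (use r in simp_all)
    then obtain g' where "\<forall>x\<in>ball c (r / 2). (\<lambda>n. h n x) \<longlonglongrightarrow> g' x \<and>
        (g' has_derivative (\<lambda>(h1, h2). a x * h1 + b x * h2)) (at x within ball c (r / 2))" ..
    moreover have "c \<in> ball c (r / 2)" using r by simp
    ultimately have g': "\<And>x. x \<in> ball c (r / 2) \<Longrightarrow> (\<lambda>n. h n x) \<longlonglongrightarrow> g' x"
      "(g' has_derivative (\<lambda>(h1, h2). a c * h1 + b c * h2)) (at c within ball c (r / 2))"
      by blast+
    have "g' x = g x" if "x \<in> ball c (r / 2)" for x
      using LIMSEQ_unique[OF g'(1)[OF that] lim] that ball_\<Omega> by auto
    moreover have "(g' has_derivative (\<lambda>(h1, h2). a c * h1 + b c * h2)) (at c)"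
      using g'(2) r by (subst (asm) at_within_open) auto
    ultimately have "(g has_derivative (\<lambda>(h1, h2). a c * h1 + b c * h2)) (at c)"
      using has_derivative_transform_within_open[of g' _ c UNIV "ball c (r / 2)" g] r by simp
    then show ?thesis by blast
  qed
  then show ?thesis unfolding holomorphic2_on_def by blast
qed

section \<open>The Bergman projection exists and is bounded for exponent 2\<close>

lemma sqnorm_nonneg: "0 \<le> sqnorm \<Omega> f"
  unfolding sqnorm_def by simp

lemma L2_mult_integrable:
  assumes "f \<in> Lp_space \<Omega> 2" "g \<in> Lp_space \<Omega> 2"
  shows "integrable (lebesgue_on \<Omega>) (\<lambda>z. f z * cnj (g z))"
proof (rule Bochner_Integration.integrable_bound)
  show "integrable (lebesgue_on \<Omega>) (\<lambda>z. (cmod (f z))\<^sup>2 + (cmod (g z))\<^sup>2)"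
    using assms by (auto simp: Lp_space_2_iff)
  have "(\<lambda>z. cnj (g z)) \<in> borel_measurable (lebesgue_on \<Omega>)"
    by (rule measurable_compose[OF _ borel_measurable_continuous_onI[OF continuous_on_cnj[OF continuous_on_id]]])
       (use assms in \<open>simp add: Lp_space_2_iff\<close>)
  then show "(\<lambda>z. f z * cnj (g z)) \<in> borel_measurable (lebesgue_on \<Omega>)"
    using assms by (auto simp: Lp_space_2_iff)
  have "cmod (a * cnj b) \<le> (cmod a)\<^sup>2 + (cmod b)\<^sup>2" for a b
  proof -
    have "2 * (cmod a * cmod b) \<le> (cmod a)\<^sup>2 + (cmod b)\<^sup>2"
      using sum_squares_bound[of "cmod a" "cmod b"] by (simp add: mult.assoc)
    moreover have "0 \<le> cmod a * cmod b" by simp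
    ultimately have "cmod a * cmod b \<le> (cmod a)\<^sup>2 + (cmod b)\<^sup>2" by linarith
    then show ?thesis by (simp add: norm_mult)
  qed
  then show "AE z in lebesgue_on \<Omega>. cmod (f z * cnj (g z)) \<le> norm ((cmod (f z))\<^sup>2 + (cmod (g z))\<^sup>2)"
    by (intro AE_I2) simp
qed

lemma L2_cmult:
  assumes "f \<in> Lp_space \<Omega> 2"
  shows "(\<lambda>z. k * f z) \<in> Lp_space \<Omega> 2"
  using assms by (auto simp: Lp_space_2_iff norm_mult power_mult_distrib)

lemma cmod_diff_squared: "(cmod (a - b))\<^sup>2 = (cmod a)\<^sup>2 - 2 * Re (a * cnj b) + (cmod b)\<^sup>2"
  unfolding cmod_power2 by (simp add: power2_eq_square algebra_simps)

lemma L2_diff: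
  assumes "f \<in> Lp_space \<Omega> 2" "g \<in> Lp_space \<Omega> 2"
  shows "(\<lambda>z. f z - g z) \<in> Lp_space \<Omega> 2"
  using assms L2_mult_integrable[OF assms]
  by (auto simp: Lp_space_2_iff cmod_diff_squared simp del: times_complex.sel)

lemma sqnorm_diff:
  assumes "f \<in> Lp_space \<Omega> 2" "g \<in> Lp_space \<Omega> 2"
  shows "sqnorm \<Omega> (\<lambda>z. f z - g z) = sqnorm \<Omega> f - 2 * Re (L2_inner \<Omega> f g) + sqnorm \<Omega> g"
proof -
  note int = L2_mult_integrable[OF assms]
  have "integrable (lebesgue_on \<Omega>) (\<lambda>z. (cmod (f z))\<^sup>2)" "integrable (lebesgue_on \<Omega>) (\<lambda>z. (cmod (g z))\<^sup>2)"
    using assms by (auto simp: Lp_space_2_iff)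
  then show ?thesis
    using int integral_Re[OF int] unfolding sqnorm_def cmod_diff_squared L2_inner_def
    by (simp del: times_complex.sel integral_Re)
qed

lemma sqnorm_cmult: "sqnorm \<Omega> (\<lambda>z. k * f z) = (cmod k)\<^sup>2 * sqnorm \<Omega> f"
  by (simp add: sqnorm_def norm_mult power_mult_distrib)

lemma L2_inner_cmult_right: "L2_inner \<Omega> f (\<lambda>z. k * g z) = cnj k * L2_inner \<Omega> f g"
  unfolding L2_inner_def by (simp add: mult.left_commute[of _ "cnj k"])

lemma L2_inner_self: "L2_inner \<Omega> f f = of_real (sqnorm \<Omega> f)"
  unfolding L2_inner_def sqnorm_def
  unfolding integral_complex_of_real[symmetric] complex_norm_square ..

lemma Bergman_space_diff:
  assumes "f \<in> Bergman_space \<Omega>" "g \<in> Bergman_space \<Omega>"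
  shows "(\<lambda>z. f z - g z) \<in> Bergman_space \<Omega>"
  using assms by (auto simp: Bergman_space_def intro: L2_diff holomorphic2_on_diff)

lemma Bergman_space_cmult:
  assumes "f \<in> Bergman_space \<Omega>"
  shows "(\<lambda>z. k * f z) \<in> Bergman_space \<Omega>"
  using assms by (auto simp: Bergman_space_def intro: L2_cmult holomorphic2_on_cmult)

text \<open>Otherwise subtracting from \<open>u\<close> a small positive multiple of \<open>L2_inner \<Omega> u h\<close> times \<open>h\<close> would
decrease its norm.\<close>

lemma orthogonal_if_closest:
  assumes u: "u \<in> Lp_space \<Omega> 2" and h: "h \<in> Lp_space \<Omega> 2"
    and closest: "\<And>k. sqnorm \<Omega> u \<le> sqnorm \<Omega> (\<lambda>z. u z - k * h z)"
  shows "L2_inner \<Omega> u h = 0"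
proof -
  let ?i = "L2_inner \<Omega> u h" and ?N = "sqnorm \<Omega> h"
  \<comment> \<open>any \<open>s > 0\<close> with \<open>s * ?N < 2\<close> serves; adding 1 covers the case \<open>?N = 0\<close>\<close>
  define s where "s = 1 / (?N + 1)"
  have N: "?N \<ge> 0" by (rule sqnorm_nonneg)
  have "sqnorm \<Omega> u \<le> sqnorm \<Omega> (\<lambda>z. u z - (of_real s * ?i) * h z)" by (rule closest)
  also have "\<dots> = sqnorm \<Omega> u - 2 * s * (cmod ?i)\<^sup>2 + s\<^sup>2 * (cmod ?i)\<^sup>2 * ?N"
  proof -
    have "Re (cnj (of_real s * ?i) * ?i) = s * (cmod ?i)\<^sup>2"
      unfolding cmod_power2 by (simp add: power2_eq_square algebra_simps)
    then show ?thesis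
      by (simp add: sqnorm_diff[OF u L2_cmult[OF h]] L2_inner_cmult_right sqnorm_cmult norm_mult
            power_mult_distrib del: complex_cnj_mult)
  qed
  finally have "(cmod ?i)\<^sup>2 * (s * (2 - s * ?N)) \<le> 0" by (simp add: algebra_simps power2_eq_square)
  moreover have "s * (2 - s * ?N) > 0"
  proof -
    have "s * ?N \<le> 1" "s > 0" using N by (simp_all add: s_def)
    then show ?thesis by simp
  qed
  ultimately have "(cmod ?i)\<^sup>2 \<le> 0" using mult_pos_pos by (meson not_less)
  then show ?thesis by simp
qed

text \<open>The parallelogram law makes a minimizing sequence Cauchy in norm. By the pointwise bound it is then
locally uniformly Cauchy, so it has a pointwise limit \<open>g\<close>, which is holomorphic. Fatou's lemma shows that
\<open>g\<close> is at the minimal distance from \<open>f\<close>; in particular \<open>g\<close> is square integrable.\<close>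

lemma Bergman_space_closest_point:
  assumes f: "f \<in> Lp_space \<Omega> 2" and \<Omega>: "open \<Omega>"
  obtains g where "g \<in> Bergman_space \<Omega>" "\<And>z. z \<notin> \<Omega> \<Longrightarrow> g z = 0"
    "\<And>h. h \<in> Bergman_space \<Omega> \<Longrightarrow> sqnorm \<Omega> (\<lambda>z. f z - g z) \<le> sqnorm \<Omega> (\<lambda>z. f z - h z)"
proof -
  let ?dist = "\<lambda>h. sqnorm \<Omega> (\<lambda>z. f z - h z)"
  define d where "d = (INF h\<in>Bergman_space \<Omega>. ?dist h)"
  have "((\<lambda>_. 0) has_derivative (\<lambda>(h1, h2). 0 * h1 + 0 * h2)) (at z)" for z :: "complex \<times> complex"
    by (simp add: case_prod_unfold)
  then have "holomorphic2_on (\<lambda>_. 0) \<Omega>" unfolding holomorphic2_on_def by blast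
  then have "(\<lambda>_. 0) \<in> Bergman_space \<Omega>" by (simp add: Bergman_space_def Lp_space_2_iff)
  then have ne: "Bergman_space \<Omega> \<noteq> {}" by blast
  have bdd: "bdd_below (?dist ` Bergman_space \<Omega>)" by (intro bdd_belowI2[of _ 0] sqnorm_nonneg)
  have d: "d \<le> ?dist h" if "h \<in> Bergman_space \<Omega>" for h
    unfolding d_def by (rule cINF_lower[OF bdd that])
  have "\<exists>h\<in>Bergman_space \<Omega>. ?dist h < d + 1 / Suc n" for n
    using cINF_less_iff[OF ne bdd, of "d + 1 / Suc n"] unfolding d_def by simp
  then obtain h where h: "\<And>n. h n \<in> Bergman_space \<Omega>" and hd: "\<And>n. ?dist (h n) < d + 1 / Suc n"
    by metis
  have L2h: "h n \<in> Lp_space \<Omega> 2" and holh: "holomorphic2_on (h n) \<Omega>" for n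
    using h by (auto simp: Bergman_space_def)
  have L2d: "(\<lambda>z. f z - h n z) \<in> Lp_space \<Omega> 2" for n by (rule L2_diff[OF f L2h])
  have int2: "integrable (lebesgue_on \<Omega>) (\<lambda>z. (cmod (u z))\<^sup>2)" if "u \<in> Lp_space \<Omega> 2" for u
    using that by (simp add: Lp_space_2_iff)
  have close: "sqnorm \<Omega> (\<lambda>z. h m z - h n z) \<le> 2 / Suc m + 2 / Suc n" for m n
  proof -
    \<comment> \<open>the midpoint, as a competitor at distance at least \<open>d\<close>\<close>
    define k where "k z = (1/2) * (h m z - (-1) * h n z)" for z
    have k: "k \<in> Bergman_space \<Omega>"
      unfolding k_def by (intro Bergman_space_cmult Bergman_space_diff h)
    then have kd: "(\<lambda>z. f z - k z) \<in> Lp_space \<Omega> 2" by (auto simp: Bergman_space_def intro: L2_diff f)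
    have "(cmod (h m z - h n z))\<^sup>2 = 2 * (cmod (f z - h m z))\<^sup>2 + 2 * (cmod (f z - h n z))\<^sup>2
        - 4 * (cmod (f z - k z))\<^sup>2" for z
      unfolding cmod_power2 k_def by (simp add: power2_eq_square field_simps)
    then have "sqnorm \<Omega> (\<lambda>z. h m z - h n z) = (LINT z|lebesgue_on \<Omega>.
        2 * (cmod (f z - h m z))\<^sup>2 + 2 * (cmod (f z - h n z))\<^sup>2 - 4 * (cmod (f z - k z))\<^sup>2)"
      unfolding sqnorm_def by (simp only:)
    also have "\<dots> = 2 * ?dist (h m) + 2 * ?dist (h n) - 4 * ?dist k"
      using int2[OF L2d[of m]] int2[OF L2d[of n]] int2[OF kd] unfolding sqnorm_def by simp
    finally show ?thesis using hd[of m] hd[of n] d[OF k] by simp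
  qed
  have Cauchy: "\<exists>r>0. cball c r \<subseteq> \<Omega> \<and> uniformly_Cauchy_on (cball c r) h" if c: "c \<in> \<Omega>" for c
  proof -
    obtain R where R: "R > 0" "ball c R \<subseteq> \<Omega>" using c \<Omega> openE by blast
    define V where "V = measure lborel (ball (0 :: complex \<times> complex) (R / 2))"
    have V: "V > 0" unfolding V_def using R by (simp add: content_ball_pos)
    have "uniformly_Cauchy_on (cball c (R / 2)) h"
    proof (rule uniformly_Cauchy_onI)
      fix e :: real assume e: "e > 0"
      then obtain N where N: "inverse (real (Suc N)) < e\<^sup>2 * V / 4"
        using reals_Archimedean[of "e\<^sup>2 * V / 4"] V by auto
      have "dist (h m z) (h n z) < e" if mn: "m \<ge> N" "n \<ge> N" and z: "z \<in> cball c (R / 2)" for m n z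
      proof -
        have "ball z (R / 2) \<subseteq> \<Omega>"
        proof
          fix y assume "y \<in> ball z (R / 2)"
          then have "y \<in> ball c R" using z dist_triangle[of c y z] by simp
          then show "y \<in> \<Omega>" using R by blast
        qed
        from Bergman_space_pointwise_bound[OF Bergman_space_diff[OF h[of m] h[of n]] \<Omega> this]
        have "(cmod (h m z - h n z))\<^sup>2 * V \<le> 2 / Suc m + 2 / Suc n"
          using close[of m n] by (simp add: V_def)
        also have "\<dots> \<le> 2 / Suc N + 2 / Suc N"
          using mn by (intro add_mono divide_left_mono) auto
        also have "\<dots> = 4 * inverse (real (Suc N))" by (simp add: inverse_eq_divide)
        also have "\<dots> < e\<^sup>2 * V" using N by simp
        finally have "(cmod (h m z - h n z))\<^sup>2 < e\<^sup>2" using V by simp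
        then show ?thesis using e by (simp add: dist_norm power_less_imp_less_base)
      qed
      then show "\<exists>M. \<forall>x\<in>cball c (R / 2). \<forall>m\<ge>M. \<forall>n\<ge>M. dist (h m x) (h n x) < e" by blast
    qed
    moreover have "cball c (R / 2) \<subseteq> \<Omega>" using R by auto
    ultimately show ?thesis using R by (intro exI[of _ "R / 2"]) auto
  qed
  define g where "g z = (if z \<in> \<Omega> then lim (\<lambda>n. h n z) else 0)" for z
  have lim: "(\<lambda>n. h n z) \<longlonglongrightarrow> g z" if "z \<in> \<Omega>" for z
  proof -
    from Cauchy[OF that] have "Cauchy (\<lambda>n. h n z)"
      by (metis centre_in_cball less_imp_le uniformly_Cauchy_imp_Cauchy)
    then show ?thesis using that by (simp add: g_def Cauchy_convergent_iff convergent_LIMSEQ_iff)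
  qed
  have holg: "holomorphic2_on g \<Omega>"
    by (rule holomorphic2_on_locally_uniform_limit[OF holh \<Omega> Cauchy lim])
  have meas_fg: "(\<lambda>z. f z - g z) \<in> borel_measurable (lebesgue_on \<Omega>)"
    using f continuous_on_open_measurable_lebesgue_on[OF \<Omega> holomorphic2_on_imp_continuous_on[OF holg]]
    by (auto simp: Lp_space_2_iff)
  have fatou: "(\<integral>\<^sup>+z. ennreal ((cmod (f z - g z))\<^sup>2) \<partial>lebesgue_on \<Omega>) \<le> ennreal d"
  proof -
    have "(\<integral>\<^sup>+z. ennreal ((cmod (f z - g z))\<^sup>2) \<partial>lebesgue_on \<Omega>)
        = (\<integral>\<^sup>+z. liminf (\<lambda>n. ennreal ((cmod (f z - h n z))\<^sup>2)) \<partial>lebesgue_on \<Omega>)"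
    proof (rule nn_integral_cong)
      fix z assume "z \<in> space (lebesgue_on \<Omega>)"
      then have "(\<lambda>n. ennreal ((cmod (f z - h n z))\<^sup>2)) \<longlonglongrightarrow> ennreal ((cmod (f z - g z))\<^sup>2)"
        by (intro tendsto_intros lim) simp
      from lim_imp_Liminf[OF _ this]
      show "ennreal ((cmod (f z - g z))\<^sup>2) = liminf (\<lambda>n. ennreal ((cmod (f z - h n z))\<^sup>2))" by simp
    qed
    also have "\<dots> \<le> liminf (\<lambda>n. \<integral>\<^sup>+z. ennreal ((cmod (f z - h n z))\<^sup>2) \<partial>lebesgue_on \<Omega>)"
      using L2d by (intro nn_integral_liminf) (auto simp: Lp_space_2_iff)
    also have "\<dots> \<le> liminf (\<lambda>n. ennreal (d + 1 / Suc n))"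
    proof (rule Liminf_mono, rule always_eventually, rule allI)
      fix n
      have "(\<integral>\<^sup>+z. ennreal ((cmod (f z - h n z))\<^sup>2) \<partial>lebesgue_on \<Omega>) = ennreal (?dist (h n))"
        unfolding sqnorm_def by (rule nn_integral_eq_integral[OF int2[OF L2d]]) simp
      then show "(\<integral>\<^sup>+z. ennreal ((cmod (f z - h n z))\<^sup>2) \<partial>lebesgue_on \<Omega>) \<le> ennreal (d + 1 / Suc n)"
        using hd[of n] by (simp add: ennreal_leI)
    qed
    also have "\<dots> = ennreal d"
    proof (rule lim_imp_Liminf)
      have "(\<lambda>n. d + 1 / Suc n) \<longlonglongrightarrow> d + 0"
        by (intro tendsto_intros lim_1_over_n[THEN LIMSEQ_Suc])
      then show "(\<lambda>n. ennreal (d + 1 / Suc n)) \<longlonglongrightarrow> ennreal d"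
        by (intro tendsto_ennrealI) simp
    qed simp
    finally show ?thesis .
  qed
  have int_fg: "integrable (lebesgue_on \<Omega>) (\<lambda>z. (cmod (f z - g z))\<^sup>2)"
    using meas_fg order.strict_trans1[OF fatou ennreal_less_top] by (intro integrableI_bounded) auto
  have "d \<ge> 0" unfolding d_def by (rule cINF_greatest[OF ne]) (rule sqnorm_nonneg)
  then have dist_g: "?dist g \<le> d"
    using fatou unfolding sqnorm_def by (subst (asm) nn_integral_eq_integral[OF int_fg]) auto
  have "(\<lambda>z. f z - g z) \<in> Lp_space \<Omega> 2" using meas_fg int_fg by (simp add: Lp_space_2_iff)
  from L2_diff[OF f this] have "g \<in> Lp_space \<Omega> 2" by simp
  then have "g \<in> Bergman_space \<Omega>" using holg by (simp add: Bergman_space_def)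
  then show ?thesis
  proof (rule that)
    show "g z = 0" if "z \<notin> \<Omega>" for z using that by (simp add: g_def)
    show "?dist g \<le> ?dist k" if "k \<in> Bergman_space \<Omega>" for k using dist_g d[OF that] by simp
  qed
qed

lemma L2_inner_diff_left:
  assumes "f \<in> Lp_space \<Omega> 2" "g \<in> Lp_space \<Omega> 2" "h \<in> Lp_space \<Omega> 2"
  shows "L2_inner \<Omega> (\<lambda>z. f z - g z) h = L2_inner \<Omega> f h - L2_inner \<Omega> g h"
  unfolding L2_inner_def left_diff_distrib
  by (intro Bochner_Integration.integral_diff L2_mult_integrable assms)

lemma Bergman_space_sqnorm_eq_0D:
  assumes u: "u \<in> Bergman_space \<Omega>" and \<Omega>: "open \<Omega>" and zero: "sqnorm \<Omega> u = 0" and c: "c \<in> \<Omega>"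
  shows "u c = 0"
proof -
  obtain r where r: "r > 0" "ball c r \<subseteq> \<Omega>" using c \<Omega> openE by blast
  have "(cmod (u c))\<^sup>2 * measure lborel (ball (0 :: complex \<times> complex) r) \<le> 0"
    using Bergman_space_pointwise_bound[OF u \<Omega> r(2)] zero by simp
  moreover have "measure lborel (ball (0 :: complex \<times> complex) r) > 0"
    using r by (simp add: content_ball_pos)
  ultimately show ?thesis by (simp add: mult_le_0_iff)
qed

lemma Bergman_projection_eqI:
  assumes f: "f \<in> Lp_space \<Omega> 2" and \<Omega>: "open \<Omega>"
    and g: "g \<in> Bergman_space \<Omega>" "\<And>z. z \<notin> \<Omega> \<Longrightarrow> g z = 0"
    and orth: "\<And>h. h \<in> Bergman_space \<Omega> \<Longrightarrow> L2_inner \<Omega> (\<lambda>z. f z - g z) h = 0"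
  shows "Bergman_projection \<Omega> f = g"
  unfolding Bergman_projection_def
proof (rule the_equality)
  fix k assume k: "k \<in> Bergman_space \<Omega> \<and> (\<forall>z. z \<notin> \<Omega> \<longrightarrow> k z = 0) \<and>
    (\<forall>h\<in>Bergman_space \<Omega>. L2_inner \<Omega> (\<lambda>z. f z - k z) h = 0)"
  define u where "u = (\<lambda>z. k z - g z)"
  have u: "u \<in> Bergman_space \<Omega>" unfolding u_def using k g by (intro Bergman_space_diff) auto
  have L2: "g \<in> Lp_space \<Omega> 2" "k \<in> Lp_space \<Omega> 2" "u \<in> Lp_space \<Omega> 2"
    using g k u by (auto simp: Bergman_space_def)
  have "L2_inner \<Omega> f u = L2_inner \<Omega> g u" "L2_inner \<Omega> f u = L2_inner \<Omega> k u"
    using orth[OF u] k u by (auto simp: L2_inner_diff_left f L2)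
  then have "L2_inner \<Omega> u u = 0"
    using L2_inner_diff_left[OF L2(2) L2(1) L2(3)] by (simp flip: u_def)
  then have "sqnorm \<Omega> u = 0" by (simp add: L2_inner_self)
  from Bergman_space_sqnorm_eq_0D[OF u \<Omega> this] have "k z = g z" if "z \<in> \<Omega>" for z
    using that by (simp add: u_def)
  moreover have "k z = g z" if "z \<notin> \<Omega>" for z using that k g(2) by metis
  ultimately show "k = g" by blast
qed (use g orth in blast)

lemma Bergman_projection_orthogonal:
  assumes f: "f \<in> Lp_space \<Omega> 2" and \<Omega>: "open \<Omega>"
  shows "Bergman_projection \<Omega> f \<in> Bergman_space \<Omega>"
    and "\<And>h. h \<in> Bergman_space \<Omega> \<Longrightarrow> L2_inner \<Omega> (\<lambda>z. f z - Bergman_projection \<Omega> f z) h = 0"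
proof -
  obtain g where g: "g \<in> Bergman_space \<Omega>" "\<And>z. z \<notin> \<Omega> \<Longrightarrow> g z = 0"
    and closest: "\<And>h. h \<in> Bergman_space \<Omega> \<Longrightarrow> sqnorm \<Omega> (\<lambda>z. f z - g z) \<le> sqnorm \<Omega> (\<lambda>z. f z - h z)"
    using Bergman_space_closest_point[OF f \<Omega>] by blast
  have orth: "L2_inner \<Omega> (\<lambda>z. f z - g z) h = 0" if h: "h \<in> Bergman_space \<Omega>" for h
  proof (rule orthogonal_if_closest)
    show "(\<lambda>z. f z - g z) \<in> Lp_space \<Omega> 2" "h \<in> Lp_space \<Omega> 2"
      using f g h by (auto simp: Bergman_space_def intro: L2_diff)
    fix k
    have "(\<lambda>z. g z - (- k) * h z) \<in> Bergman_space \<Omega>"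
      by (rule Bergman_space_diff[OF g(1) Bergman_space_cmult[OF h]])
    from closest[OF this]
    show "sqnorm \<Omega> (\<lambda>z. f z - g z) \<le> sqnorm \<Omega> (\<lambda>z. f z - g z - k * h z)" by (simp add: algebra_simps)
  qed
  have "Bergman_projection \<Omega> f = g" by (rule Bergman_projection_eqI[OF f \<Omega> g orth])
  then show "Bergman_projection \<Omega> f \<in> Bergman_space \<Omega>"
    and "\<And>h. h \<in> Bergman_space \<Omega> \<Longrightarrow> L2_inner \<Omega> (\<lambda>z. f z - Bergman_projection \<Omega> f z) h = 0"
    using g orth by auto
qed

lemma Lp_norm_2: "Lp_norm \<Omega> 2 f = sqrt (sqnorm \<Omega> f)"
  using sqnorm_nonneg[of \<Omega> f] by (simp add: Lp_norm_def sqnorm_def powr_numeral powr_half_sqrt)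

text \<open>Pythagoras: \<open>\<parallel>f\<parallel>\<^sup>2 = \<parallel>f - B f\<parallel>\<^sup>2 + \<parallel>B f\<parallel>\<^sup>2\<close>.\<close>

lemma Bergman_projection_bounded_on_L2:
  assumes \<Omega>: "open \<Omega>"
  shows "bounded_on_Lp \<Omega> 2 (Bergman_projection \<Omega>)"
  unfolding bounded_on_Lp_def
proof (intro exI[of _ 1] conjI ballI)
  fix f assume "f \<in> Lp_space \<Omega> 2 \<inter> Lp_space \<Omega> 2"
  then have f: "f \<in> Lp_space \<Omega> 2" by simp
  let ?g = "Bergman_projection \<Omega> f"
  note g = Bergman_projection_orthogonal[OF f \<Omega>]
  show L2g: "?g \<in> Lp_space \<Omega> 2" using g(1) by (simp add: Bergman_space_def)
  have "L2_inner \<Omega> f ?g = of_real (sqnorm \<Omega> ?g)"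
    using g(2)[OF g(1)] by (simp add: L2_inner_diff_left[OF f L2g L2g] L2_inner_self)
  then have "sqnorm \<Omega> f = sqnorm \<Omega> (\<lambda>z. f z - ?g z) + sqnorm \<Omega> ?g"
    by (simp add: sqnorm_diff[OF f L2g])
  then show "Lp_norm \<Omega> 2 ?g \<le> 1 * Lp_norm \<Omega> 2 f"
    using sqnorm_nonneg[of \<Omega> "\<lambda>z. f z - ?g z"] by (simp add: Lp_norm_2)
qed simp

section \<open>Moments of the modulus of the first coordinate\<close>

lemma open_H_infinity: "open H_infinity"
proof -
  let ?U = "{z :: complex \<times> complex. fst z \<noteq> 0} \<inter> {z. cmod (fst z) < 1}"
  let ?g = "\<lambda>z :: complex \<times> complex. exp (- (1 / cmod (fst z))) - cmod (snd z)"
  have U: "open ?U"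
    by (intro open_Int open_Collect_neq open_Collect_less continuous_intros)
  have "continuous_on ?U ?g" by (auto intro!: continuous_intros)
  then have "open (?U \<inter> ?g -` {0<..})" using U by (rule continuous_open_preimage) simp
  also have "?U \<inter> ?g -` {0<..} = H_infinity" by (auto simp: H_infinity_def)
  finally show ?thesis .
qed

definition radial_moment :: "real \<Rightarrow> real" where
  "radial_moment s = (LINT z|lebesgue_on H_infinity. cmod (fst z) powr (- s))"

lemma continuous_on_H_infinity_radial:
  "continuous_on H_infinity (\<lambda>z. cmod (fst z) powr s)"
  by (auto intro!: continuous_intros simp: H_infinity_def)

text \<open>With \<open>u = 1 / r\<close> the left-hand side is \<open>u powr s * exp (- 2 * u)\<close>, which is maximal at \<open>u = s / 2\<close>.\<close>

lemma powr_neg_times_exp_le: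
  assumes s: "0 < s" and r: "0 < (r::real)"
  shows "r powr (- s) * exp (- 2 / r) \<le> (s / (2 * exp 1)) powr s"
proof -
  have "ln (2 / (r * s)) \<le> 2 / (r * s) - 1" using s r by (intro ln_le_minus_one) simp
  then have "s * ln (2 / (r * s)) \<le> s * (2 / (r * s) - 1)" using s by (intro mult_left_mono) auto
  then have "- s * ln r - 2 / r \<le> s * (ln s - ln 2 - 1)"
    using s r by (simp add: ln_div ln_mult algebra_simps)
  then have "exp (- s * ln r - 2 / r) \<le> exp (s * (ln s - ln 2 - 1))" by simp
  also have "exp (s * (ln s - ln 2 - 1)) = (s / (2 * exp 1)) powr s"
    using s by (simp add: powr_def ln_div ln_mult)
  also have "exp (- s * ln r - 2 / r) = r powr (- s) * exp (- 2 / r)"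
    using r by (simp add: powr_def flip: exp_add)
  finally show ?thesis .
qed

text \<open>The fibre over \<open>z\<^sub>1\<close> is a disc of area \<open>\<pi> exp (- 2 / |z\<^sub>1|)\<close>, so the integral over it is at most the
maximum just found times \<open>\<pi>\<close>, and the base is the punctured unit disc.\<close>

lemma nn_integral_radial_le:
  assumes s: "0 < s"
  shows "(\<integral>\<^sup>+z. ennreal (indicator H_infinity z *\<^sub>R (cmod (fst z) powr (- s))) \<partial>lborel)
    \<le> ennreal (pi\<^sup>2 * (s / (2 * exp 1)) powr s)"
proof -
  let ?K = "(s / (2 * exp 1)) powr s"
  define F where "F z = ennreal (indicator H_infinity z *\<^sub>R (cmod (fst z) powr (- s)))" for z
  have "F \<in> borel_measurable borel"
    unfolding F_def by (intro measurable_compose[OF _ measurable_ennreal]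
        continuous_on_open_indicator_measurable open_H_infinity continuous_on_H_infinity_radial)
  then have "(\<integral>\<^sup>+z. F z \<partial>lborel) = (\<integral>\<^sup>+x. \<integral>\<^sup>+y. F (x, y) \<partial>lborel \<partial>lborel)"
    using lborel.nn_integral_fst[of F lborel] by (simp add: lborel_prod borel_prod)
  also have "\<dots> \<le> (\<integral>\<^sup>+x. ennreal (pi * ?K) * indicator (ball (0::complex) 1) x \<partial>lborel)"
  proof (rule nn_integral_mono)
    fix x :: complex
    show "(\<integral>\<^sup>+y. F (x, y) \<partial>lborel) \<le> ennreal (pi * ?K) * indicator (ball 0 1) x"
    proof (cases "0 < cmod x \<and> cmod x < 1")
      case True
      have "F (x, y) = ennreal (cmod x powr (- s)) * indicator (ball 0 (exp (- (1 / cmod x)))) y" for y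
        using True by (simp add: F_def H_infinity_def indicator_def)
      then have "(\<integral>\<^sup>+y. F (x, y) \<partial>lborel)
          = ennreal (cmod x powr (- s)) * emeasure lborel (ball (0::complex) (exp (- (1 / cmod x))))"
        by (simp add: nn_integral_cmult_indicator)
      also have "emeasure lborel (ball (0::complex) (exp (- (1 / cmod x)))) = ennreal (pi * exp (- 2 / cmod x))"
        by (subst emeasure_ball) (simp_all add: unit_ball_vol_2 power2_eq_square flip: exp_add)
      also have "ennreal (cmod x powr (- s)) * ennreal (pi * exp (- 2 / cmod x))
          = ennreal (pi * (cmod x powr (- s) * exp (- 2 / cmod x)))"
        by (simp add: mult_ac flip: ennreal_mult)
      also have "\<dots> \<le> ennreal (pi * ?K)"
        using True powr_neg_times_exp_le[OF s, of "cmod x"] by (intro ennreal_leI mult_left_mono) auto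
      finally show ?thesis using True by simp
    next
      case False
      then have "F (x, y) = 0" for y by (auto simp: F_def H_infinity_def indicator_def)
      then show ?thesis by simp
    qed
  qed
  also have "\<dots> = ennreal (pi * ?K) * emeasure lborel (ball (0::complex) 1)"
    by (simp add: nn_integral_cmult_indicator)
  also have "\<dots> = ennreal (pi\<^sup>2 * ?K)"
    by (subst emeasure_ball) (simp_all add: unit_ball_vol_2 power2_eq_square mult_ac flip: ennreal_mult)
  finally show ?thesis unfolding F_def .
qed

lemma
  assumes s: "0 < s"
  shows integrable_radial: "integrable (lebesgue_on H_infinity) (\<lambda>z. cmod (fst z) powr (- s))"
    and radial_moment_le: "radial_moment s \<le> pi\<^sup>2 * (s / (2 * exp 1)) powr s"
proof -
  let ?F = "\<lambda>z. indicator H_infinity z *\<^sub>R (cmod (fst z) powr (- s))"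
  have "?F \<in> borel_measurable borel"
    by (intro continuous_on_open_indicator_measurable open_H_infinity continuous_on_H_infinity_radial)
  then have meas: "?F \<in> borel_measurable lborel" by simp
  have int: "integrable lborel ?F"
    using meas order.strict_trans1[OF nn_integral_radial_le[OF s] ennreal_less_top]
    by (intro integrableI_nonneg) auto
  then show "integrable (lebesgue_on H_infinity) (\<lambda>z. cmod (fst z) powr (- s))"
    by (subst integrable_lebesgue_on_open_iff[OF open_H_infinity continuous_on_H_infinity_radial])
  have "radial_moment s = (\<integral>z. ?F z \<partial>lborel)"
    unfolding radial_moment_def
    by (rule integral_lebesgue_on_open[OF open_H_infinity continuous_on_H_infinity_radial])
  moreover have "ennreal (\<integral>z. ?F z \<partial>lborel) = (\<integral>\<^sup>+z. ennreal (?F z) \<partial>lborel)"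
    by (rule nn_integral_eq_integral[OF int, symmetric]) simp
  ultimately have "ennreal (radial_moment s) \<le> ennreal (pi\<^sup>2 * (s / (2 * exp 1)) powr s)"
    using nn_integral_radial_le[OF s] by (simp only:)
  then show "radial_moment s \<le> pi\<^sup>2 * (s / (2 * exp 1)) powr s"
    by (subst (asm) ennreal_le_iff) auto
qed

text \<open>Up to a power of \<open>s\<close> the upper bound is attained: near the maximum, for \<open>s / 2 < 1 / |z\<^sub>1| < s / 2 + 1\<close>,
the integrand is within a constant factor of the maximum, and this annulus contains a disc whose
radius is about \<open>2 / s\<^sup>2\<close>. Above that disc a product of two discs lies inside the domain.\<close>

lemma radial_moment_ge:
  assumes s: "2 \<le> s"
  shows "pi\<^sup>2 * exp (- 2) / s ^ 4 * (s / (2 * exp 1)) powr s \<le> radial_moment s"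
proof -
  define a b where "a = 2 / (s + 2)" and "b = 2 / s"
  define \<rho> R where "\<rho> = (b - a) / 2" and "R = exp (- (s + 2) / 2)"
  define B where "B = ball (of_real ((a + b) / 2) :: complex) \<rho> \<times> ball (0 :: complex) R"
  have ab: "0 < a" "a < b" "b \<le> 1" using s by (simp_all add: a_def b_def field_simps)
  then have \<rho>: "0 < \<rho>" by (simp add: \<rho>_def)
  have BH: "z \<in> H_infinity" and Bb: "cmod (fst z) \<le> b" if z: "z \<in> B" for z
  proof -
    let ?m = "of_real ((a + b) / 2) :: complex"
    have d: "cmod (?m - fst z) < \<rho>" "cmod (snd z) < R" using z by (auto simp: B_def dist_norm)
    have m: "cmod ?m = (a + b) / 2" unfolding norm_of_real using ab by simp
    have lo: "a < cmod (fst z)"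
      using d(1) m norm_triangle_ineq2[of ?m "fst z"] unfolding \<rho>_def by argo
    have hi: "cmod (fst z) < b"
      using d(1) m norm_triangle_ineq2[of "fst z" ?m] norm_minus_commute[of "fst z" ?m]
      unfolding \<rho>_def by argo
    have "1 / cmod (fst z) < 1 / a" using lo ab frac_less2[of 1 1 a "cmod (fst z)"] by simp
    then have "R \<le> exp (- (1 / cmod (fst z)))" by (simp add: R_def a_def)
    then show "z \<in> H_infinity" using d(2) lo hi ab by (auto simp: H_infinity_def case_prod_unfold)
    show "cmod (fst z) \<le> b" using hi by simp
  qed
  have open_B: "open B" unfolding B_def by (intro open_Times) auto
  have fin: "emeasure lborel B < \<infinity>"
    unfolding B_def by (intro emeasure_bounded_finite bounded_Times) auto
  have vol: "measure lborel B = pi * \<rho>\<^sup>2 * (pi * R\<^sup>2)"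
  proof -
    have "emeasure lborel B = emeasure lborel (ball (of_real ((a + b) / 2) :: complex) \<rho>)
        * emeasure lborel (ball (0 :: complex) R)"
      unfolding B_def by (subst lborel_prod[symmetric], subst lborel.emeasure_pair_measure_Times) auto
    also have "\<dots> = ennreal (pi * \<rho>\<^sup>2 * (pi * R\<^sup>2))"
      using \<rho> by (subst (1 2) emeasure_ball)
        (simp_all add: R_def unit_ball_vol_2 flip: ennreal_mult)
    finally show ?thesis by (simp add: measure_def)
  qed
  have "pi\<^sup>2 * exp (- 2) / s ^ 4 * (s / (2 * exp 1)) powr s
      \<le> b powr (- s) * (pi * \<rho>\<^sup>2 * (pi * R\<^sup>2))"
  proof -
    have "s \<noteq> 0" "s + 2 \<noteq> 0" using s by auto
    then have "\<rho> = 2 / (s * (s + 2))"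
      unfolding \<rho>_def a_def b_def by (simp add: divide_simps)
    also have "\<dots> \<ge> 2 / (s * (2 * s))" using s by (intro divide_left_mono mult_left_mono) auto
    finally have "1 / s\<^sup>2 \<le> \<rho>" by (simp add: power2_eq_square)
    then have "(1 / s\<^sup>2)\<^sup>2 \<le> \<rho>\<^sup>2" by (intro power_mono) auto
    then have \<rho>4: "1 / s ^ 4 \<le> \<rho>\<^sup>2" by (simp add: power_divide flip: power_mult)
    have R2: "R\<^sup>2 = exp (- s) * exp (- 2)"
      unfolding R_def power2_eq_square by (simp flip: exp_add)
    have "(s / (2 * exp 1)) powr s = (s / 2 * exp (- 1)) powr s"
      by (simp add: exp_minus field_simps)
    also have "\<dots> = (s / 2) powr s * exp (- s)"
      using s by (subst powr_mult) (auto simp: exp_powr_real)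
    also have "(s / 2) powr s = b powr (- s)"
      using s by (simp add: b_def powr_minus powr_divide)
    finally have bs: "(s / (2 * exp 1)) powr s = b powr (- s) * exp (- s)" .
    have "pi\<^sup>2 * exp (- 2) / s ^ 4 * (s / (2 * exp 1)) powr s
        = (pi\<^sup>2 * b powr (- s) * exp (- s) * exp (- 2)) * (1 / s ^ 4)" by (simp add: bs)
    also have "\<dots> \<le> (pi\<^sup>2 * b powr (- s) * exp (- s) * exp (- 2)) * \<rho>\<^sup>2"
      by (intro mult_left_mono \<rho>4) simp
    finally show ?thesis unfolding R2 by (simp add: power2_eq_square mult_ac)
  qed
  also have "b powr (- s) * (pi * \<rho>\<^sup>2 * (pi * R\<^sup>2)) = (\<integral>z. indicator B z *\<^sub>R (b powr (- s)) \<partial>lborel)"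
    using fin open_B by (subst integral_scaleR_left) (auto simp: vol intro!: integrable_real_indicator)
  also have "\<dots> \<le> (\<integral>z. indicator H_infinity z *\<^sub>R (cmod (fst z) powr (- s)) \<partial>lborel)"
  proof (rule integral_mono)
    show "integrable lborel (\<lambda>z. indicator B z *\<^sub>R (b powr (- s)))"
      using fin open_B by (intro integrable_scaleR_left integrable_real_indicator) auto
    show "integrable lborel (\<lambda>z. indicator H_infinity z *\<^sub>R (cmod (fst z) powr (- s)))"
      using integrable_radial[of s] s
      unfolding integrable_lebesgue_on_open_iff[OF open_H_infinity continuous_on_H_infinity_radial] by simp
    fix z :: "complex \<times> complex"
    have "b powr (- s) \<le> cmod (fst z) powr (- s)" if "z \<in> B"
      using Bb[OF that] BH[OF that] s
      by (intro powr_mono2') (auto simp: H_infinity_def case_prod_unfold)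
    then show "indicator B z *\<^sub>R (b powr (- s)) \<le> indicator H_infinity z *\<^sub>R (cmod (fst z) powr (- s))"
      using BH by (auto simp: indicator_def)
  qed
  also have "\<dots> = radial_moment s"
    unfolding radial_moment_def
    by (rule integral_lebesgue_on_open[OF open_H_infinity continuous_on_H_infinity_radial, symmetric])
  finally show ?thesis .
qed

text \<open>The fourth power is the loss in the lower bound for the moments.\<close>

lemma quartic_less_exponential:
  assumes x: "1 < (x::real)"
  shows "\<exists>n::nat. n \<ge> 2 \<and> K * real n ^ 4 < x ^ n"
proof -
  define y where "y = root 4 x"
  have y: "1 < y" "y ^ 4 = x" using x by (auto simp: y_def)
  have "(\<lambda>n. (of_nat n / y ^ n) ^ 4) \<longlonglongrightarrow> 0 ^ 4"
    by (intro tendsto_power lim_n_over_pown) (use y in simp)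
  then have "(\<lambda>n. \<bar>K\<bar> * (of_nat n / y ^ n) ^ 4) \<longlonglongrightarrow> \<bar>K\<bar> * 0"
    by (intro tendsto_intros) simp
  then have "\<forall>\<^sub>F n in sequentially. \<bar>K\<bar> * (of_nat n / y ^ n) ^ 4 < 1"
    by (intro order_tendstoD(2)[where y = "\<bar>K\<bar> * 0"]) auto
  then have "\<forall>\<^sub>F n in sequentially. n \<ge> 2 \<and> \<bar>K\<bar> * (of_nat n / y ^ n) ^ 4 < 1"
    using eventually_ge_at_top[of 2] by eventually_elim auto
  then obtain n :: nat where n: "n \<ge> 2" "\<bar>K\<bar> * (real n / y ^ n) ^ 4 < 1"
    using eventually_happens'[OF sequentially_bot] by blast
  have "(y ^ n) ^ 4 = x ^ n" using y(2) by (metis mult.commute power_mult)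
  then have "\<bar>K\<bar> * real n ^ 4 < x ^ n"
    using n(2) x by (simp add: power_divide field_simps)
  moreover have "K * real n ^ 4 \<le> \<bar>K\<bar> * real n ^ 4" by (intro mult_right_mono) auto
  ultimately show ?thesis using n(1) by (intro exI[of _ n]) linarith
qed

section \<open>The projection of a radial function times a monomial\<close>

lemma circle_mean_mult_cnj:
  "(\<integral>t. indicator {0..1::real} t *\<^sub>R (c * cnj (g t)) \<partial>lborel)
    = c * cnj (\<integral>t. indicator {0..1} t *\<^sub>R g t \<partial>lborel)"
proof -
  have "(\<integral>t. indicator {0..1::real} t *\<^sub>R (c * cnj (g t)) \<partial>lborel)
      = (\<integral>t. c * cnj (indicator {0..1} t *\<^sub>R g t) \<partial>lborel)"
    by (simp add: mult_ac)
  also have "\<dots> = c * (\<integral>t. cnj (indicator {0..1} t *\<^sub>R g t) \<partial>lborel)"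
    by (rule integral_mult_right_zero)
  finally show ?thesis by (simp only: Bochner_Integration.integral_cnj)
qed

text \<open>Average the integrand \<open>k * cnj h\<close> first over the rotations of \<open>z\<^sub>2\<close>: since \<open>k\<close> depends on \<open>z\<^sub>1\<close> only, the
mean value property replaces \<open>h (z\<^sub>1, z\<^sub>2)\<close> by \<open>h (z\<^sub>1, 0)\<close>. Averaging next over the rotations of \<open>z\<^sub>1\<close>
replaces \<open>h (z\<^sub>1, 0)\<close> by its Laurent term \<open>A z\<^sub>1\<^sup>-\<^sup>n\<close>. What remains is \<open>cnj A\<close> times
the integral that vanishes by hypothesis. So only the monomial itself has to be tested against \<open>k\<close>.\<close>

lemma L2_inner_radial_times_monomial_eq_0:
  fixes \<phi> :: "real \<Rightarrow> real" and n :: nat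
  defines "k \<equiv> \<lambda>z. of_real (\<phi> (cmod (fst z))) * inverse (fst z) ^ n"
  assumes \<phi>: "continuous_on {0<..<1} \<phi>" and k: "k \<in> Lp_space H_infinity 2"
    and zero: "(LINT z|lebesgue_on H_infinity. \<phi> (cmod (fst z)) * inverse (cmod (fst z)) ^ (2 * n)) = 0"
    and h: "h \<in> Bergman_space H_infinity"
  shows "L2_inner H_infinity k h = 0"
proof -
  have hol: "holomorphic2_on h H_infinity" and L2h: "h \<in> Lp_space H_infinity 2"
    using h by (auto simp: Bergman_space_def)
  have fst0: "fst z \<noteq> 0" "cmod (fst z) \<in> {0<..<1}" if "z \<in> H_infinity" for z
    using that by (auto simp: H_infinity_def)
  have cont_\<phi>: "continuous_on H_infinity (\<lambda>z. \<phi> (cmod (fst z)))"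
    by (rule continuous_on_compose2[OF \<phi>]) (auto intro!: continuous_intros dest: fst0)
  have cont_h: "continuous_on H_infinity h" using hol by (rule holomorphic2_on_imp_continuous_on)
  have cont: "continuous_on H_infinity (\<lambda>z. k z * cnj (h z))"
    unfolding k_def by (intro continuous_intros cont_\<phi> cont_h) (use fst0 in auto)
  define I where "I z = indicat_real H_infinity z" for z
  have I_rot: "I (u * x, v * y) = I (x, y)" if "cmod u = 1" "cmod v = 1" for u v x y
    using that by (simp add: I_def H_infinity_def indicator_def norm_mult) auto
  define F where "F z = I z *\<^sub>R (k z * cnj (h z))" for z
  define F0 where "F0 z = I z *\<^sub>R (k z * cnj (h (fst z, 0)))" for z
  have int_F: "integrable lborel F"
    using L2_mult_integrable[OF k L2h] unfolding F_def I_def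
    by (subst (asm) integrable_lebesgue_on_open_iff[OF open_H_infinity cont])
  define T1 where "T1 t = (\<lambda>(x :: complex, y :: complex). (1 * x, unit_exp t * y))" for t
  have "distr lborel borel (T1 t) = lborel" for t
    unfolding T1_def by (rule distr_lborel_rotate_pair) simp_all
  moreover have "continuous_on UNIV (\<lambda>(t, z). T1 t z)"
    unfolding T1_def case_prod_unfold by (intro continuous_intros)
  moreover have mean1: "(\<integral>t. indicator {0..1} t *\<^sub>R F (T1 t z) \<partial>lborel) = F0 z" for z
  proof -
    obtain x y where z: "z = (x, y)" by fastforce
    have FT: "F (T1 t z) = (I z *\<^sub>R k z) * cnj (h (x, unit_exp t * y))" for t
      using I_rot[of 1 "unit_exp t" x y] by (simp add: F_def T1_def z k_def)
    have "I z *\<^sub>R (\<integral>t. indicator {0..1} t *\<^sub>R h (x, unit_exp t * y) \<partial>lborel) = I z *\<^sub>R h (x, 0)"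
    proof (cases "z \<in> H_infinity")
      case True
      have "(x + w * 0, 0 + w * y) \<in> H_infinity" if "w \<in> cball 0 1" for w
      proof -
        have "cmod (w * y) \<le> cmod y" using that by (simp add: norm_mult mult_left_le_one_le)
        then show ?thesis using True by (auto simp: H_infinity_def z)
      qed
      from circle_mean_holomorphic[OF holomorphic2_on_complex_line[OF hol this]]
      show ?thesis by simp
    qed (simp add: I_def)
    then show ?thesis
      unfolding FT circle_mean_mult_cnj F0_def
      by (cases "I z = 0") (simp_all add: z)
  qed
  ultimately have int_F0: "integrable lborel F0" and F_F0: "(\<integral>z. F z \<partial>lborel) = (\<integral>z. F0 z \<partial>lborel)"
    using integral_flow_average[OF _ _ int_F, of T1] by simp_all
  define g where "g w = w ^ n * h (w, 0)" for w
  have holg: "g holomorphic_on ball 0 1 - {0}"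
  proof -
    have "(\<lambda>w. h (0 + w * 1, 0 + w * 0)) holomorphic_on ball 0 1 - {0}"
      by (rule holomorphic2_on_complex_line[OF hol]) (simp add: H_infinity_def)
    then show ?thesis unfolding g_def by (intro holomorphic_intros) simp
  qed
  \<comment> \<open>the Laurent coefficient of \<open>h (_, 0)\<close> of index \<open>- n\<close>, read off at the arbitrary radius 1/2\<close>
  define A where "A = (\<integral>t. indicator {0..1} t *\<^sub>R g (unit_exp t * (1 / 2)) \<partial>lborel)"
  define T2 where "T2 t = (\<lambda>(x :: complex, y :: complex). (unit_exp t * x, 1 * y))" for t
  have "distr lborel borel (T2 t) = lborel" for t
    unfolding T2_def by (rule distr_lborel_rotate_pair) simp_all
  moreover have "continuous_on UNIV (\<lambda>(t, z). T2 t z)"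
    unfolding T2_def case_prod_unfold by (intro continuous_intros)
  moreover have "(\<integral>t. indicator {0..1} t *\<^sub>R F0 (T2 t z) \<partial>lborel)
      = of_real (indicator H_infinity z *\<^sub>R (\<phi> (cmod (fst z)) * inverse (cmod (fst z)) ^ (2 * n))) * cnj A" for z
  proof -
    obtain x y where z: "z = (x, y)" by fastforce
    let ?r = "of_real (I z * (\<phi> (cmod x) * inverse (cmod x) ^ (2 * n))) :: complex"
    have FT: "F0 (T2 t z) = ?r * cnj (g (unit_exp t * x))" for t
    proof -
      let ?u = "unit_exp t * x"
      have "inverse ?u ^ n = of_real (inverse (cmod ?u) ^ (2 * n)) * cnj (?u ^ n)"
      proof -
        have "inverse w = of_real (inverse (cmod w) ^ 2) * cnj w" for w
          using complex_div_cnj[of 1 w] by (simp add: field_simps)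
        from this[of ?u] have "inverse ?u ^ n = (of_real (inverse (cmod ?u) ^ 2) * cnj ?u) ^ n" by (rule arg_cong)
        then show ?thesis by (simp add: power_mult_distrib power_mult)
      qed
      then show ?thesis
        using I_rot[of "unit_exp t" 1 x y]
        by (simp add: F0_def T2_def z k_def g_def norm_mult scaleR_conv_of_real)
    qed
    show ?thesis
    proof (cases "z \<in> H_infinity")
      case True
      then have "0 < cmod x" "cmod x < 1" by (auto simp: H_infinity_def z)
      then have "(\<integral>t. indicator {0..1} t *\<^sub>R g (unit_exp t * x) \<partial>lborel) = A"
        unfolding A_def by (intro circle_mean_punctured_disc_constant[OF holg]) auto
      then show ?thesis unfolding FT circle_mean_mult_cnj by (simp add: z I_def)
    qed (simp add: FT I_def)
  qed
  ultimately have "(\<integral>z. F0 z \<partial>lborel) = (\<integral>z. of_real (indicator H_infinity z *\<^sub>R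
      (\<phi> (cmod (fst z)) * inverse (cmod (fst z)) ^ (2 * n))) * cnj A \<partial>lborel)"
    using integral_flow_average(2)[OF _ _ int_F0, of T2] by simp
  also have "\<dots> = of_real (\<integral>z. indicator H_infinity z *\<^sub>R
      (\<phi> (cmod (fst z)) * inverse (cmod (fst z)) ^ (2 * n)) \<partial>lborel) * cnj A"
    unfolding integral_mult_left_zero integral_complex_of_real ..
  also have "(\<integral>z. indicator H_infinity z *\<^sub>R (\<phi> (cmod (fst z)) * inverse (cmod (fst z)) ^ (2 * n)) \<partial>lborel) = 0"
  proof (subst integral_lebesgue_on_open[OF open_H_infinity, symmetric])
    show "continuous_on H_infinity (\<lambda>z. \<phi> (cmod (fst z)) * inverse (cmod (fst z)) ^ (2 * n))"
      by (intro continuous_intros cont_\<phi>) (use fst0 in auto)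
  qed (rule zero)
  finally have "(\<integral>z. F z \<partial>lborel) = 0" by (simp add: F_F0)
  then show ?thesis
    unfolding L2_inner_def F_def I_def
    by (subst integral_lebesgue_on_open[OF open_H_infinity cont])
qed

lemma holomorphic2_on_inverse_fst_power:
  "holomorphic2_on (\<lambda>z. inverse (fst z) ^ n) H_infinity"
  unfolding holomorphic2_on_def
proof
  fix z :: "complex \<times> complex" assume "z \<in> H_infinity"
  then have "fst z \<noteq> 0" by (auto simp: H_infinity_def)
  then have "(\<lambda>w. inverse w ^ n) field_differentiable at (fst z)"
    by (intro derivative_intros) auto
  then obtain d where "((\<lambda>w. inverse w ^ n) has_derivative (*) d) (at (fst z))"
    unfolding field_differentiable_def has_field_derivative_def by blast
  from has_derivative_compose[OF has_derivative_fst[OF has_derivative_ident] this]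
  have "((\<lambda>z. inverse (fst z) ^ n) has_derivative (\<lambda>(h1, h2). d * h1 + 0 * h2)) (at z)"
    by (simp add: case_prod_unfold)
  then show "\<exists>a b. ((\<lambda>z. inverse (fst z) ^ n) has_derivative (\<lambda>(h1, h2). a * h1 + b * h2)) (at z)" by blast
qed

lemma
  fixes f :: "complex \<times> complex \<Rightarrow> complex"
  assumes f: "continuous_on H_infinity f"
    and norm: "\<And>z. z \<in> H_infinity \<Longrightarrow> cmod (f z) = c * cmod (fst z) powr (- s)"
    and c: "0 \<le> c" and s: "0 < s" and p: "0 < p"
  shows Lp_space_radial: "f \<in> Lp_space H_infinity p"
    and Lp_norm_radial: "Lp_norm H_infinity p f = c * radial_moment (p * s) powr (1 / p)"
proof -
  have eq: "cmod (f z) powr p = c powr p * cmod (fst z) powr (- (p * s))" if "z \<in> H_infinity" for z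
    using norm[OF that] c by (simp add: powr_mult powr_powr mult.commute)
  have "integrable (lebesgue_on H_infinity) (\<lambda>z. c powr p * cmod (fst z) powr (- (p * s)))"
    using s p by (intro integrable_mult_right integrable_radial) simp
  also have "?this \<longleftrightarrow> integrable (lebesgue_on H_infinity) (\<lambda>z. cmod (f z) powr p)"
    by (rule Bochner_Integration.integrable_cong) (simp_all add: eq)
  finally show "f \<in> Lp_space H_infinity p"
    using continuous_on_open_measurable_lebesgue_on[OF open_H_infinity f] by (simp add: Lp_space_def)
  have "(LINT z|lebesgue_on H_infinity. cmod (f z) powr p)
      = (LINT z|lebesgue_on H_infinity. c powr p * cmod (fst z) powr (- (p * s)))"
    by (rule Bochner_Integration.integral_cong) (simp_all add: eq)
  also have "\<dots> = c powr p * radial_moment (p * s)" by (simp add: radial_moment_def)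
  finally show "Lp_norm H_infinity p f = c * radial_moment (p * s) powr (1 / p)"
    using c p by (simp add: Lp_norm_def powr_mult powr_powr radial_moment_def)
qed

lemma cmod_inverse_power_eq_powr:
  assumes "z \<in> H_infinity"
  shows "cmod (inverse (fst z) ^ n) = cmod (fst z) powr (- real n)"
  using assms by (simp add: norm_power norm_inverse powr_minus powr_realpow power_inverse H_infinity_def case_prod_unfold)

text \<open>The coefficient is the one for which the difference is orthogonal to the monomial.\<close>

lemma Bergman_projection_radial_times_monomial:
  fixes a :: real and n :: nat
  assumes n: "0 < n" and a: "- real n < a"
  shows "Bergman_projection H_infinity (\<lambda>z. of_real (cmod (fst z) powr (- a)) * inverse (fst z) ^ n)
    = (\<lambda>z. if z \<in> H_infinity
         then of_real (radial_moment (a + 2 * n) / radial_moment (2 * n)) * inverse (fst z) ^ n else 0)"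
    (is "Bergman_projection _ ?f = ?g")
proof (rule Bergman_projection_eqI[OF _ open_H_infinity])
  define c where "c = radial_moment (a + 2 * n) / radial_moment (2 * n)"
  have fst0: "fst z \<noteq> 0" if "z \<in> H_infinity" for z using that by (auto simp: H_infinity_def)
  have pos: "radial_moment (2 * n) > 0"
  proof -
    have "0 < pi\<^sup>2 * exp (- 2) / real (2 * n) ^ 4 * (real (2 * n) / (2 * exp 1)) powr real (2 * n)"
      using n by (intro mult_pos_pos divide_pos_pos) auto
    also have "\<dots> \<le> radial_moment (2 * n)" using n by (intro radial_moment_ge) simp
    finally show ?thesis .
  qed
  have cont_mono: "continuous_on H_infinity (\<lambda>z. inverse (fst z) ^ n)"
    by (intro holomorphic2_on_imp_continuous_on holomorphic2_on_inverse_fst_power)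
  have mono: "(\<lambda>z. inverse (fst z) ^ n) \<in> Bergman_space H_infinity"
    unfolding Bergman_space_def
    using Lp_space_radial[OF cont_mono, of 1 "real n" 2] n
    by (simp add: cmod_inverse_power_eq_powr holomorphic2_on_inverse_fst_power)
  show f: "?f \<in> Lp_space H_infinity 2"
  proof (rule Lp_space_radial[where c = 1 and s = "a + n"])
    show "continuous_on H_infinity ?f"
      by (intro continuous_intros cont_mono continuous_on_H_infinity_radial)
    show "cmod (?f z) = 1 * cmod (fst z) powr - (a + real n)" if "z \<in> H_infinity" for z
      using fst0[OF that]
      by (simp only: norm_mult cmod_inverse_power_eq_powr[OF that]) (simp flip: powr_add)
  qed (use a in simp_all)
  have cmono: "(\<lambda>z. of_real c * inverse (fst z) ^ n) \<in> Bergman_space H_infinity"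
    by (rule Bergman_space_cmult[OF mono])
  show g: "?g \<in> Bergman_space H_infinity"
  proof -
    have "?g \<in> Lp_space H_infinity 2 \<longleftrightarrow> (\<lambda>z. of_real c * inverse (fst z) ^ n) \<in> Lp_space H_infinity 2"
      unfolding Lp_space_def mem_Collect_eq
      by (intro conj_cong measurable_cong Bochner_Integration.integrable_cong refl)
         (simp_all add: c_def)
    moreover have "holomorphic2_on ?g H_infinity"
      using cmono open_H_infinity unfolding Bergman_space_def
      by (auto intro: holomorphic2_on_cong simp: c_def)
    ultimately show ?thesis using cmono by (simp add: Bergman_space_def)
  qed
  show "?g z = 0" if "z \<notin> H_infinity" for z using that by simp
  fix h assume h: "h \<in> Bergman_space H_infinity"
  define \<phi> where "\<phi> r = r powr (- a) - c" for r
  have fg: "?f z - of_real c * inverse (fst z) ^ n = of_real (\<phi> (cmod (fst z))) * inverse (fst z) ^ n" for z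
    by (simp add: \<phi>_def algebra_simps)
  have "L2_inner H_infinity (\<lambda>z. of_real (\<phi> (cmod (fst z))) * inverse (fst z) ^ n) h = 0"
  proof (rule L2_inner_radial_times_monomial_eq_0[OF _ _ _ h])
    show "continuous_on {0<..<1} \<phi>" unfolding \<phi>_def by (auto intro!: continuous_intros)
    show "(\<lambda>z. of_real (\<phi> (cmod (fst z))) * inverse (fst z) ^ n) \<in> Lp_space H_infinity 2"
      using L2_diff[OF f, of "\<lambda>z. of_real c * inverse (fst z) ^ n"] cmono
      unfolding fg Bergman_space_def by simp
    have "(LINT z|lebesgue_on H_infinity. \<phi> (cmod (fst z)) * inverse (cmod (fst z)) ^ (2 * n))
        = (LINT z|lebesgue_on H_infinity. cmod (fst z) powr (- (a + 2 * n)) - c * cmod (fst z) powr (- (2 * n)))"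
    proof (rule Bochner_Integration.integral_cong[OF refl])
      fix z assume "z \<in> space (lebesgue_on H_infinity)"
      then have z: "z \<in> H_infinity" by simp
      have "inverse (cmod (fst z)) ^ (2 * n) = cmod (fst z) powr (- (2 * n))"
        using cmod_inverse_power_eq_powr[OF z, of "2 * n"] by (simp add: norm_power norm_inverse)
      moreover have "cmod (fst z) powr (- a) * cmod (fst z) powr (- (2 * n)) = cmod (fst z) powr (- (a + 2 * n))"
        by (simp flip: powr_add)
      ultimately show "\<phi> (cmod (fst z)) * inverse (cmod (fst z)) ^ (2 * n)
          = cmod (fst z) powr (- (a + 2 * n)) - c * cmod (fst z) powr (- (2 * n))"
        by (simp add: \<phi>_def left_diff_distrib)
    qed
    also have "\<dots> = radial_moment (a + 2 * n) - c * radial_moment (2 * n)"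
      unfolding radial_moment_def using a n integrable_radial[of "a + 2 * n"] integrable_radial[of "2 * n"]
      by (subst Bochner_Integration.integral_diff) auto
    finally show "(LINT z|lebesgue_on H_infinity. \<phi> (cmod (fst z)) * inverse (cmod (fst z)) ^ (2 * n)) = 0"
      using pos by (simp add: c_def)
  qed
  also have "L2_inner H_infinity (\<lambda>z. of_real (\<phi> (cmod (fst z))) * inverse (fst z) ^ n) h
      = L2_inner H_infinity (\<lambda>z. ?f z - ?g z) h"
    unfolding L2_inner_def
    by (rule Bochner_Integration.integral_cong[OF refl]) (simp add: fg[symmetric] c_def)
  finally show "L2_inner H_infinity (\<lambda>z. ?f z - ?g z) h = 0" .
qed

text \<open>Up to polynomial factors the moment of order \<open>s\<close> is \<open>(s / 2e) powr s\<close>. Therefore the quotient of the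
right-hand side by the moment of order \<open>2 n\<close> is, up to a power of \<open>n\<close>, equal to
\<open>(p n / 2e) ^ n * (q n / 2e) ^ n / (n / e) ^ (2 n) = (p q / 4) ^ n\<close>.
For conjugate exponents \<open>p q = p + q\<close>, and \<open>p q > 4\<close> unless \<open>p = q = 2\<close>.\<close>

lemma radial_moment_Hoelder_quotient_unbounded:
  assumes p: "1 < p" "p \<noteq> 2" and q: "q = p / (p - 1)"
  shows "\<exists>n::nat. 2 \<le> n \<and> C * radial_moment (2 * real n)
    < radial_moment (p * real n) powr (1 / p) * radial_moment (q * real n) powr (1 / q)"
proof -
  have q1: "1 < q" and inv: "1 / p + 1 / q = 1" using p by (auto simp: q field_simps)
  have "0 < (p - 2)\<^sup>2" using p by simp
  then have pq: "1 < p * q / 4" using p by (simp add: q power2_eq_square field_simps)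
  obtain n :: nat where n: "n \<ge> 2" and
    big: "(max C 0 * exp 2 * (p * q) ^ 4) * real n ^ 4 < (p * q / 4) ^ n"
    using quartic_less_exponential[OF pq] by blast
  define M where "M = pi\<^sup>2 * exp (- 2) / (p * q * n) ^ 4"
  have M: "0 < M" using p q1 n by (simp add: M_def)
  have lower: "M powr (1 / s) * (s * n / (2 * exp 1)) ^ n \<le> radial_moment (s * n) powr (1 / s)"
    if s: "1 < s" "s \<le> p * q" for s
  proof -
    have sn: "2 \<le> s * n" using s n mult_mono[of 1 s 2 "real n"] by simp
    have "M \<le> pi\<^sup>2 * exp (- 2) / (s * n) ^ 4"
      unfolding M_def using s n sn p q1
      by (intro divide_left_mono power_mono mult_right_mono mult_pos_pos zero_less_power) auto
    then have "M * (s * n / (2 * exp 1)) powr (s * n)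
        \<le> pi\<^sup>2 * exp (- 2) / (s * n) ^ 4 * (s * n / (2 * exp 1)) powr (s * n)"
      by (intro mult_right_mono) auto
    also have "\<dots> \<le> radial_moment (s * n)" by (rule radial_moment_ge[OF sn])
    finally have "(M * (s * n / (2 * exp 1)) powr (s * n)) powr (1 / s) \<le> radial_moment (s * n) powr (1 / s)"
      using s M by (intro powr_mono2) auto
    also have "(M * (s * n / (2 * exp 1)) powr (s * n)) powr (1 / s) = M powr (1 / s) * (s * n / (2 * exp 1)) ^ n"
      using s M n by (simp add: powr_mult powr_powr powr_realpow)
    finally show ?thesis .
  qed
  have "C * radial_moment (2 * real n) \<le> max C 0 * radial_moment (2 * real n)"
    by (intro mult_right_mono) (auto simp: radial_moment_def)
  also have "\<dots> \<le> max C 0 * (pi\<^sup>2 * (n / exp 1) ^ (2 * n))"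
  proof (intro mult_left_mono)
    have "(2 * real n / (2 * exp 1)) powr (2 * n) = (n / exp 1) ^ (2 * n)"
      using n by (subst powr_realpow) auto
    then show "radial_moment (2 * real n) \<le> pi\<^sup>2 * (n / exp 1) ^ (2 * n)"
      using radial_moment_le[of "2 * real n"] n by simp
  qed simp
  also have "\<dots> = M * ((max C 0 * exp 2 * (p * q) ^ 4) * real n ^ 4) * (n / exp 1) ^ (2 * n)"
    using p q1 n by (simp add: M_def power_mult_distrib exp_minus field_simps)
  also have "\<dots> < M * (p * q / 4) ^ n * (n / exp 1) ^ (2 * n)"
    using big M n by (intro mult_strict_right_mono mult_strict_left_mono) auto
  also have "\<dots> = (M powr (1 / p) * M powr (1 / q)) * ((p * n / (2 * exp 1)) ^ n * (q * n / (2 * exp 1)) ^ n)"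
  proof -
    have "M powr (1 / p) * M powr (1 / q) = M" using M inv by (simp flip: powr_add)
    moreover have "(p * q / 4) ^ n * (n / exp 1) ^ (2 * n) = (p * n / (2 * exp 1)) ^ n * (q * n / (2 * exp 1)) ^ n"
      unfolding power_mult power_mult_distrib[symmetric]
      by (rule arg_cong[where f = "\<lambda>x. x ^ n"]) (simp add: power2_eq_square field_simps)
    ultimately show ?thesis by simp
  qed
  also have "\<dots> = (M powr (1 / p) * (p * n / (2 * exp 1)) ^ n) * (M powr (1 / q) * (q * n / (2 * exp 1)) ^ n)"
    by simp
  also have "\<dots> \<le> radial_moment (p * n) powr (1 / p) * radial_moment (q * n) powr (1 / q)"
    using p q1 by (intro mult_mono lower) auto
  finally show ?thesis using n by blast
qed

section \<open>Boundedness only for exponent 2\<close>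

theorem theorem1p3:
  fixes p :: real
  assumes "1 < p"
  shows "bounded_on_Lp H_infinity p (Bergman_projection H_infinity) \<longleftrightarrow> p = 2"
proof
  assume "p = 2"
  then show "bounded_on_Lp H_infinity p (Bergman_projection H_infinity)"
    using Bergman_projection_bounded_on_L2[OF open_H_infinity] by simp
next
  assume "bounded_on_Lp H_infinity p (Bergman_projection H_infinity)"
  then obtain C where C: "\<And>f. f \<in> Lp_space H_infinity 2 \<Longrightarrow> f \<in> Lp_space H_infinity p \<Longrightarrow>
      Lp_norm H_infinity p (Bergman_projection H_infinity f) \<le> C * Lp_norm H_infinity p f"
    unfolding bounded_on_Lp_def by blast
  show "p = 2"
  proof (rule ccontr)
    assume "p \<noteq> 2"
    define q where "q = p / (p - 1)"
    have q: "1 < q" "p * (q - 1) = q" "1 - 1 / p = 1 / q" using assms by (auto simp: q_def field_simps)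
    obtain n :: nat where n: "n \<ge> 2" and large: "C * radial_moment (2 * real n)
        < radial_moment (p * n) powr (1 / p) * radial_moment (q * n) powr (1 / q)"
      using radial_moment_Hoelder_quotient_unbounded[OF assms \<open>p \<noteq> 2\<close> q_def] by blast
    let ?J = radial_moment
    have pos: "0 < ?J (s * n)" if "1 < s" for s :: real
    proof -
      have "2 \<le> s * n" using that n mult_mono[of 1 s 2 "real n"] by simp
      from order.strict_trans2[OF _ radial_moment_ge[OF this]] show ?thesis
        using that n by simp
    qed
    \<comment> \<open>the extremal function in Hoelder's inequality for the pairing with \<open>z\<^sub>1\<^sup>-\<^sup>n\<close>:
      \<open>|f|\<^sup>p\<close>, \<open>|z\<^sub>1\<^sup>-\<^sup>n|\<^sup>q\<close> and \<open>f * cnj (z\<^sub>1\<^sup>-\<^sup>n)\<close> all equal \<open>|z\<^sub>1| powr (- q n)\<close>\<close>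
    let ?f = "\<lambda>z :: complex \<times> complex. of_real (cmod (fst z) powr (- (n * (q - 2)))) * inverse (fst z) ^ n :: complex"
    let ?g = "Bergman_projection H_infinity ?f"
    have cont_mono: "continuous_on H_infinity (\<lambda>z. inverse (fst z) ^ n)"
      by (intro holomorphic2_on_imp_continuous_on holomorphic2_on_inverse_fst_power)
    have cont_f: "continuous_on H_infinity ?f"
      by (intro continuous_intros cont_mono continuous_on_H_infinity_radial)
    have norm_f: "cmod (?f z) = 1 * cmod (fst z) powr (- (n * (q - 1)))" if "z \<in> H_infinity" for z
      by (simp only: norm_mult cmod_inverse_power_eq_powr[OF that])
         (simp add: algebra_simps flip: powr_add)
    have f: "?f \<in> Lp_space H_infinity r" if "0 < r" for r
      using n q by (intro Lp_space_radial[OF cont_f norm_f]) (auto simp: that)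
    have "Lp_norm H_infinity p ?f = 1 * ?J (p * (n * (q - 1))) powr (1 / p)"
      using n q assms by (intro Lp_norm_radial[OF cont_f norm_f]) auto
    also have "p * (n * (q - 1)) = q * n" using q(2) by (metis mult.commute mult.left_commute)
    finally have norm_pf: "Lp_norm H_infinity p ?f = ?J (q * n) powr (1 / p)" by simp
    define c where "c = ?J (q * n) / ?J (2 * real n)"
    have "n * (q - 2) + 2 * n = q * n" by (simp add: algebra_simps)
    then have c_eq: "?J (n * (q - 2) + 2 * n) / ?J (real (2 * n)) = c" by (simp add: c_def)
    have "0 < real n * (q - 1)" using n q by simp
    then have "- real n < n * (q - 2)" by (simp add: algebra_simps)
    then have g: "?g = (\<lambda>z. if z \<in> H_infinity then of_real c * inverse (fst z) ^ n else 0)"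
      using Bergman_projection_radial_times_monomial[of n "n * (q - 2)"] n unfolding c_eq by simp
    have "c \<ge> 0" using pos[OF q(1)] pos[of 2] by (simp add: c_def)
    have "Lp_norm H_infinity p ?g = c * ?J (p * n) powr (1 / p)"
    proof (rule Lp_norm_radial)
      have "continuous_on H_infinity (\<lambda>z. of_real c * inverse (fst z) ^ n)"
        by (intro continuous_intros cont_mono)
      then show "continuous_on H_infinity ?g" unfolding g by (rule continuous_on_eq) simp
      show "cmod (?g z) = c * cmod (fst z) powr - real n" if "z \<in> H_infinity" for z
        using that \<open>c \<ge> 0\<close> by (simp add: g norm_mult cmod_inverse_power_eq_powr)
    qed (use \<open>c \<ge> 0\<close> n assms in auto)
    then have "c * ?J (p * n) powr (1 / p) \<le> C * ?J (q * n) powr (1 / p)"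
      using C[OF f f, of ] assms norm_pf by simp
    then have bound: "?J (q * n) * ?J (p * n) powr (1 / p) \<le> C * ?J (2 * real n) * ?J (q * n) powr (1 / p)"
      using pos[of 2] by (simp add: c_def field_simps)
    define A B where "A = ?J (q * n) powr (1 / q)" and "B = ?J (q * n) powr (1 / p)"
    have AB: "?J (q * n) = A * B"
      using pos[OF q(1)] by (simp add: A_def B_def q(3)[symmetric] flip: powr_add)
    have "0 < B" using pos[OF q(1)] by (simp add: B_def)
    have "(?J (p * n) powr (1 / p) * A) * B \<le> (C * ?J (2 * real n)) * B"
      using bound[folded B_def, unfolded AB] by (simp add: mult_ac)
    then have "?J (p * n) powr (1 / p) * A \<le> C * ?J (2 * real n)"
      using \<open>0 < B\<close> by (rule mult_right_le_imp_le)
    then show False using large by (simp add: A_def)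
  qed
qed

end
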